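(* Let $\beta\in\mathbb{R}$, let $\psi\in\mathfrak{M}$, and suppose that the characteristics $\alpha(t)=\frac{\psi(t)}{t|\psi'(t)|}$ and $\lambda(t)=\frac{\psi(t)}{|\psi'(t)|}$ satisfy $\alpha(t)\downarrow 0$ and $\lambda(t)\uparrow\infty$ as $t\to\infty$. Then for all $n\in\mathbb{N}$ such that $\alpha(n)<\frac14$ and for every function $f\in C^{\psi}_{\beta}L_1$ $$\|f(\cdot)-S_{n-1}(f;\cdot)\|_{C}\le\psi(n)\lambda(n)\left(\frac1\pi+\frac{\xi_3}{\lambda(n)}+\xi_4\,\alpha(n)\right)E_{n}(f^{\psi}_{\beta})_{L_1},$$ where $0\le\xi_3\le\frac{1}{\pi}$ and $0\le\xi_4\le\frac{4}{3\pi}$. Moreover, for every function $f\in C^{\psi}_{\beta}L_1$ there exists a function $\mathcal{F}(x)=\mathcal{F}(f;n,x)$ in $C^{\psi}_{\beta}L_1$ such that $E_n(\mathcal{F}^{\psi}_{\beta})_{L_1}=E_n(f^{\psi}_{\beta})_{L_1}$ and, for $n\in\mathbb{N}$ such that $\alpha(n)<\frac14$, $$\|\mathcal{F}(\cdot)-S_{n-1}(\mathcal{F};\cdot)\|_{C}=\psi(n)\lambda(n)\left(\frac1\pi+\frac{\xi_5}{\lambda(n)}+\xi_6\,\alpha(n)\right)E_{n}(f^{\psi}_{\beta})_{L_1},$$ where $-2\le\xi_5\le2+\frac1\pi$ and $-8\le\xi_6\le\frac43\left(2+\frac1\pi\right)$.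
   Context: All functions in the approximation classes are real-valued and $2\pi$-periodic; $\mathbb{N}=\{1,2,\dots\}$. $L_1$ is the space of $2\pi$-periodic functions summable on $[0,2\pi)$ with norm $\|f\|_1=\int_0^{2\pi}|f(t)|\,dt$; $C$ is the space of continuous $2\pi$-periodic functions with norm $\|f\|_C=\max_t|f(t)|$. $\mathfrak{M}$ is the set of all positive continuous convex (downward) functions $\psi(t)$, $t\ge1$, with $\lim_{t\to\infty}\psi(t)=0$. For $\psi\in\mathfrak{M}$, $\psi'(t):=\psi'(t+0)$ denotes the right derivative. The notation $\alpha(t)\downarrow0$ (resp. $\lambda(t)\uparrow\infty$) means that $\alpha$ is monotonically non-increasing on $[1,\infty)$ with limit $0$ (resp. $\lambda$ is monotonically non-decreasing on $[1,\infty)$ with limit $\infty$). The sequence $\psi(k)$, $k=1,2,\dots$, is the restriction of $\psi(t)$ to the natural numbers. With $\Psi_\beta(t)=\sum_{k=1}^{\infty}\psi(k)\cos\left(kt-\frac{\beta\pi}{2}\right)$, $C^{\psi}_{\beta}L_1$ is the set of $2\pi$-periodic functions $f$ which for all $x\in\mathbb{R}$ have the form $$f(x)=\frac{a_0}{2}+\frac1\pi\int_{-\pi}^{\pi}\Psi_\beta(x-t)\varphi(t)\,dt,\qquad a_0\in\mathbb{R},\ \varphi\in L_1,\ \int_{-\pi}^{\pi}\varphi(t)\,dt=0.$$ The function $\varphi$ in this representation is called the $(\psi,\beta)$-derivative of $f$ and is denoted $f^{\psi}_{\beta}$. $S_{n-1}(f;\cdot)$ is the partial Fourier sum of $f$ of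 order $n-1$. For $g\in L_1$, $E_n(g)_{L_1}=\inf\|g-t_{n-1}\|_1$, the infimum being over all trigonometric polynomials $t_{n-1}$ of order at most $n-1$. *)

theory Defs
  imports "HOL-Analysis.Analysis"
begin

text \<open>Functions on \<open>[1, \<infinity>)\<close> are represented by total functions on the reals; only the values on
  \<open>{1..}\<close> are constrained or used.\<close>

definition psi_class :: "(real \<Rightarrow> real) set" (\<open>\<MM>\<close>) where
  "\<MM> = {\<psi>. (\<forall>t\<ge>1. \<psi> t > 0) \<and> continuous_on {1..} \<psi> \<and> convex_on {1..} \<psi> \<and>
           (\<psi> \<longlongrightarrow> 0) at_top}"

definition right_deriv :: "(real \<Rightarrow> real) \<Rightarrow> real \<Rightarrow> real" where
  "right_deriv \<psi> t = vector_derivative \<psi> (at_right t)"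

definition char_alpha :: "(real \<Rightarrow> real) \<Rightarrow> real \<Rightarrow> real" where
  "char_alpha \<psi> t = \<psi> t / (t * \<bar>right_deriv \<psi> t\<bar>)"

definition char_lambda :: "(real \<Rightarrow> real) \<Rightarrow> real \<Rightarrow> real" where
  "char_lambda \<psi> t = \<psi> t / \<bar>right_deriv \<psi> t\<bar>"

definition decreases_to_zero :: "(real \<Rightarrow> real) \<Rightarrow> bool" where
  "decreases_to_zero g \<longleftrightarrow> antimono_on {1..} g \<and> (g \<longlongrightarrow> 0) at_top"

definition increases_to_infinity :: "(real \<Rightarrow> real) \<Rightarrow> bool" where
  "increases_to_infinity g \<longleftrightarrow> mono_on {1..} g \<and> filterlim g at_top at_top"

definition periodic_2pi :: "(real \<Rightarrow> real) \<Rightarrow> bool" where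
  "periodic_2pi f \<longleftrightarrow> (\<forall>x. f (x + 2 * pi) = f x)"

definition L1_space :: "(real \<Rightarrow> real) set" where
  "L1_space = {f. periodic_2pi f \<and> set_integrable lebesgue {0..<2 * pi} f}"

definition L1_norm :: "(real \<Rightarrow> real) \<Rightarrow> real" where
  "L1_norm f = (LINT t:{0..<2 * pi}|lebesgue. \<bar>f t\<bar>)"

text \<open>For continuous \<open>2\<pi>\<close>-periodic functions, the only ones it is meant for, the supremum is a
  maximum.\<close>

definition C_norm :: "(real \<Rightarrow> real) \<Rightarrow> real" where
  "C_norm f = (SUP t. \<bar>f t\<bar>)"

definition fourier_cos_coeff :: "(real \<Rightarrow> real) \<Rightarrow> nat \<Rightarrow> real" where
  "fourier_cos_coeff f k = (1 / pi) * (LINT t:{-pi..pi}|lebesgue. f t * cos (real k * t))"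

definition fourier_sin_coeff :: "(real \<Rightarrow> real) \<Rightarrow> nat \<Rightarrow> real" where
  "fourier_sin_coeff f k = (1 / pi) * (LINT t:{-pi..pi}|lebesgue. f t * sin (real k * t))"

definition fourier_sum :: "nat \<Rightarrow> (real \<Rightarrow> real) \<Rightarrow> real \<Rightarrow> real" where
  "fourier_sum m f x = fourier_cos_coeff f 0 / 2 +
     (\<Sum>k=1..m. fourier_cos_coeff f k * cos (real k * x) + fourier_sin_coeff f k * sin (real k * x))"

definition trig_polys :: "nat \<Rightarrow> (real \<Rightarrow> real) set" where
  "trig_polys m = {p. \<exists>a b. p = (\<lambda>x. a 0 / 2 +
     (\<Sum>k=1..m. a k * cos (real k * x) + b k * sin (real k * x)))}"

text \<open>Used for \<open>n \<ge> 1\<close> only, so the subtraction is not truncated.\<close>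

definition best_approx_L1 :: "nat \<Rightarrow> (real \<Rightarrow> real) \<Rightarrow> real" where
  "best_approx_L1 n g = (INF p\<in>trig_polys (n - 1). L1_norm (\<lambda>x. g x - p x))"

definition Psi_kernel :: "(real \<Rightarrow> real) \<Rightarrow> real \<Rightarrow> real \<Rightarrow> real" where
  "Psi_kernel \<psi> \<beta> t = (\<Sum>j. \<psi> (real (Suc j)) * cos (real (Suc j) * t - \<beta> * pi / 2))"

text \<open>The \<open>(\<psi>, \<beta>)\<close>-derivative of \<open>f\<close> is determined only almost everywhere, so it is rendered as a
  relation between \<open>f\<close> and \<open>\<phi>\<close>; \<open>L1_norm\<close> and \<open>best_approx_L1\<close> do not depend on the
  representative.\<close>

definition has_psi_beta_derivative ::
    "(real \<Rightarrow> real) \<Rightarrow> real \<Rightarrow> (real \<Rightarrow> real) \<Rightarrow> (real \<Rightarrow> real) \<Rightarrow> bool" where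
  "has_psi_beta_derivative \<psi> \<beta> f \<phi> \<longleftrightarrow>
     \<phi> \<in> L1_space \<and> (LINT t:{-pi..pi}|lebesgue. \<phi> t) = 0 \<and>
     (\<exists>a0. \<forall>x. f x = a0 / 2 +
        (1 / pi) * (LINT t:{-pi..pi}|lebesgue. Psi_kernel \<psi> \<beta> (x - t) * \<phi> t))"

definition C_psi_beta_L1 :: "(real \<Rightarrow> real) \<Rightarrow> real \<Rightarrow> (real \<Rightarrow> real) set" where
  "C_psi_beta_L1 \<psi> \<beta> = {f. periodic_2pi f \<and> (\<exists>\<phi>. has_psi_beta_derivative \<psi> \<beta> f \<phi>)}"

end

theory Submission
  imports Defs
begin

text \<open>The remainder of the Fourier sum is the series
  \<open>f x - S\<^sub>n\<^sub>-\<^sub>1 f x = (\<Sum>k\<ge>n. \<psi> k / \<pi> * \<integral> cos (k (x - t) - \<beta>\<pi>/2) \<phi> t dt)\<close>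
  (lemma \<open>fourier_remainder_sums\<close>). A cosine of frequency \<open>k \<ge> n\<close> is orthogonal to all trigonometric
  polynomials of order below \<open>n\<close>, so each integral is at most \<open>E\<^sub>n(\<phi>)\<close> in absolute value, and the
  upper estimate is reduced to \<open>\<Sum>k\<ge>n. \<psi> k \<le> \<psi> n \<lambda>(n) (1 + 1/\<lambda>(n) + 4/3 \<alpha>(n))\<close>.

  For the second half, put almost all mass of \<open>\<Phi>\<close> into a narrow nonnegative bump \<open>g\<close> at the origin,
  made mean-free by subtracting a constant; the constant changes neither \<open>E\<^sub>n\<close> nor the remainder.
  Scaling gives \<open>E\<^sub>n(\<Phi>)\<close> the prescribed value \<open>E\<close>, and since \<open>E\<^sub>n(g) \<le> 1\<close> for a bump of mass one, the
  scaling factor is at least \<open>E\<close>. The remainder is then close to that factor times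
  \<open>\<Sum>k\<ge>n. \<psi> k / \<pi> * cos (k x - \<beta>\<pi>/2)\<close>. Some \<open>x\<close> with \<open>\<bar>x\<bar> \<le> \<pi>/n\<close> makes the phase for \<open>k = n\<close>
  vanish modulo \<open>2\<pi>\<close>, and then the cosine for \<open>k = n + j\<close> is at least \<open>1 - j \<pi>/n\<close>. Hence the sum
  is at least \<open>1/\<pi>\<close> times a quantity that falls short of \<open>\<Sum>k\<ge>n. \<psi> k \<ge> \<psi> n \<lambda>(n)\<close> by about \<open>(\<pi>/n) (\<Sum>j. j \<psi> (n + j))\<close>, which is of the order
  \<open>\<psi> n \<lambda>(n) \<alpha>(n)\<close> because \<open>\<lambda>(n) = n \<alpha>(n)\<close> (lemma \<open>extremal_function\<close>). The upper and lower estimates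
  enclose the norm of the remainder, and interpolation produces the exact constants.

  All sums over \<open>\<psi>\<close> (lemma \<open>tail_sums\<close>) come from one device: the hypotheses on \<open>\<alpha>\<close> and \<open>\<lambda>\<close> are the
  differential inequalities \<open>t \<psi>'(t) \<le> - \<psi>(t)/\<alpha>(n)\<close> and \<open>\<lambda>(n) \<psi>'(t) \<ge> - \<psi>(t)\<close> for \<open>t > n\<close>, under which
  suitable multiples \<open>p(t) \<psi>(t)\<close> with \<open>p\<close> a polynomial decrease at a rate comparable to the summand,
  so the sums telescope.\<close>

section \<open>Right derivatives and convexity\<close>

text \<open>A mean value inequality that asks only for right derivatives: if \<open>u t - (m + e) t\<close> ended above its
  initial value, consider the last point where it does not exceed that value: its right derivative
  there is negative, so it stays below a little longer, a contradiction. Excluding the left end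
  point \<open>a\<close> from the hypothesis matters, since a convex function on \<open>[1, \<infinity>)\<close> may have no finite right derivative at \<open>1\<close>.\<close>

lemma right_deriv_bound_imp_growth_bound:
  fixes u :: "real \<Rightarrow> real"
  assumes ab: "a \<le> b" and cont: "continuous_on {a..b} u"
    and der: "\<And>t. a < t \<Longrightarrow> t < b \<Longrightarrow> \<exists>D\<le>m. (u has_real_derivative D) (at_right t)"
  shows "u b - u a \<le> m * (b - a)"
proof -
  have inner: "u b - u c \<le> (m + e) * (b - c)" if c: "a < c" "c < b" and e: "e > 0" for c e
  proof (rule ccontr)
    assume neg: "\<not> ?thesis"
    define v where "v t = u t - (m + e) * t" for t
    have vb: "v c < v b" using neg by (simp add: v_def algebra_simps)
    define S where "S = {t \<in> {c..b}. v t \<le> v c}"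
    have "continuous_on {c..b} v"
      unfolding v_def using c by (intro continuous_intros continuous_on_subset[OF cont]) auto
    then have "closed S"
      unfolding S_def by (intro continuous_on_closed_Collect_le continuous_intros) auto
    moreover have "c \<in> S" and bdd: "bdd_above S" using c by (auto simp: S_def)
    ultimately have sup: "Sup S \<in> S" by (intro closed_contains_Sup) auto
    define s where "s = Sup S"
    have s: "c \<le> s" "s < b" "v s \<le> v c"
      using sup vb by (auto simp: S_def s_def order_less_le)
    obtain D where "D \<le> m" and D: "(u has_real_derivative D) (at_right s)"
      using der[of s] s c by auto
    have "(v has_real_derivative D - (m + e)) (at_right s)"
      unfolding v_def by (auto intro!: derivative_eq_intros D)
    then obtain d where "d > 0" and d: "\<And>h. 0 < h \<Longrightarrow> h < d \<Longrightarrow> v (s + h) < v s"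
      using has_real_derivative_neg_dec_right[of v "D - (m + e)" s "{s<..}"] \<open>D \<le> m\<close> e by auto
    define h where "h = min (d / 2) (b - s)"
    have "0 < h" "h < d" "s + h \<le> b" using \<open>d > 0\<close> s by (auto simp: h_def)
    then have "s + h \<in> S" using d[of h] s by (auto simp: S_def)
    then have "s + h \<le> s" unfolding s_def using bdd by (rule cSup_upper)
    then show False using \<open>0 < h\<close> by simp
  qed
  show ?thesis
  proof (cases "a < b")
    case True
    have nonstrict: "u b - u c \<le> m * (b - c)" if c: "a < c" "c < b" for c
    proof (rule field_le_epsilon)
      fix e :: real assume "e > 0"
      then show "u b - u c \<le> m * (b - c) + e"
        using inner[of c "e / (b - c)"] c by (simp add: distrib_right)
    qed
    have "((\<lambda>c. u b - u c) \<longlongrightarrow> u b - u a) (at_right a)"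
      using cont True by (auto intro!: tendsto_intros simp: continuous_on_Icc_at_rightD)
    moreover have "((\<lambda>c. m * (b - c)) \<longlongrightarrow> m * (b - a)) (at_right a)"
      by (intro tendsto_intros)
    moreover have "eventually (\<lambda>c. u b - u c \<le> m * (b - c)) (at_right a)"
      using nonstrict True by (auto simp: eventually_at_right)
    ultimately show ?thesis
      by (intro tendsto_le[of "at_right a"]) auto
  qed (use ab in simp)
qed

lemma convex_on_right_derivative:
  fixes f :: "real \<Rightarrow> real"
  assumes f: "convex_on {a..} f" and t: "a < t"
  shows "(f has_real_derivative right_deriv f t) (at_right t)"
    and "t < s \<Longrightarrow> right_deriv f t \<le> (f s - f t) / (s - t)"
proof -
  define q where "q s = (f s - f t) / (s - t)" for s
  have sl: "(f t - f x) / (t - x) = q x" for x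
    unfolding q_def by (metis minus_diff_eq minus_divide_divide)
  have mono: "q x \<le> q y" if "t < x" "x \<le> y" for x y
  proof (cases "x = y")
    case False
    with that have "(f t - f x) / (t - x) \<le> (f t - f y) / (t - y)"
      using t by (intro convex_on_slope_le(1)[OF f]) auto
    then show ?thesis unfolding sl .
  qed simp
  have bnd: "(f a - f t) / (a - t) \<le> q x" if "t < x" for x
  proof -
    have "(f a - f t) / (a - t) \<le> (f a - f x) / (a - x)"
      "(f a - f x) / (a - x) \<le> (f t - f x) / (t - x)"
      using that t by (intro convex_on_slope_le[OF f]; auto)+
    then show ?thesis unfolding sl by simp
  qed
  define L where "L = Inf (q ` {t<..})"
  have "(q \<longlongrightarrow> L) (at_right t)"
    using Lim_right_bound[of UNIV t q "(f a - f t) / (a - t)"] mono bnd by (simp add: L_def)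
  then have L: "(f has_real_derivative L) (at_right t)"
    unfolding has_field_derivative_iff q_def .
  have eq: "right_deriv f t = L"
    unfolding right_deriv_def
    by (intro vector_derivative_within) (use L in \<open>auto simp: has_real_derivative_iff_has_vector_derivative\<close>)
  with L show "(f has_real_derivative right_deriv f t) (at_right t)" by simp
  show "right_deriv f t \<le> (f s - f t) / (s - t)" if "t < s"
    unfolding eq L_def q_def[symmetric]
    using that bnd by (intro cInf_lower bdd_belowI[of _ "(f a - f t) / (a - t)"]) auto
qed

text \<open>The right derivative is below every forward secant slope, and some forward slope is negative
  because \<open>\<psi>\<close> is positive and tends to \<open>0\<close>.\<close>

lemma psi_class_right_derivative:
  assumes psi: "\<psi> \<in> \<MM>" and t: "1 < t"
  shows "(\<psi> has_real_derivative right_deriv \<psi> t) (at_right t)" and "right_deriv \<psi> t < 0"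
proof -
  have cvx: "convex_on {1..} \<psi>" and lim: "(\<psi> \<longlongrightarrow> 0) at_top" and pos: "\<psi> t > 0"
    using psi t by (auto simp: psi_class_def)
  show "(\<psi> has_real_derivative right_deriv \<psi> t) (at_right t)"
    by (rule convex_on_right_derivative(1)[OF cvx t])
  have "eventually (\<lambda>s. \<psi> s < \<psi> t \<and> t < s) at_top"
    using order_tendstoD(2)[OF lim pos] eventually_gt_at_top[of t] by eventually_elim auto
  then obtain s where s: "\<psi> s < \<psi> t" "t < s"
    by (auto simp: eventually_at_top_linorder)
  have "right_deriv \<psi> t \<le> (\<psi> s - \<psi> t) / (s - t)"
    by (rule convex_on_right_derivative(2)[OF cvx t s(2)])
  also have "\<dots> < 0" using s by (simp add: divide_neg_pos)
  finally show "right_deriv \<psi> t < 0" .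
qed

lemma psi_class_antimono:
  assumes psi: "\<psi> \<in> \<MM>" and st: "1 \<le> s" "s \<le> t"
  shows "\<psi> t \<le> \<psi> s"
proof -
  have "\<psi> t - \<psi> s \<le> 0 * (t - s)"
  proof (rule right_deriv_bound_imp_growth_bound[OF st(2)])
    show "continuous_on {s..t} \<psi>"
      using psi st by (auto simp: psi_class_def intro: continuous_on_subset)
    show "\<exists>D\<le>0. (\<psi> has_real_derivative D) (at_right r)" if "s < r" for r
      using psi_class_right_derivative[OF psi, of r] that st by (intro exI[of _ "right_deriv \<psi> r"]) auto
  qed
  then show ?thesis by simp
qed

section \<open>Tail sums of rapidly decreasing convex functions\<close>

text \<open>At \<open>n = 1\<close> the derivative in the definition of the characteristics need not exist; the monotonicity
  of \<open>\<alpha>\<close> and \<open>\<lambda>\<close> still transfers their values at \<open>n\<close> to inequalities at every \<open>t > n\<close>, where it does.\<close>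

lemma characteristic_bounds:
  fixes n t :: real
  assumes psi: "\<psi> \<in> \<MM>"
    and dec: "decreases_to_zero (char_alpha \<psi>)" and inc: "increases_to_infinity (char_lambda \<psi>)"
    and n: "1 \<le> n"
  shows "0 < char_alpha \<psi> n" and "char_lambda \<psi> n = n * char_alpha \<psi> n"
    and "n < t \<Longrightarrow> t * right_deriv \<psi> t \<le> - \<psi> t / char_alpha \<psi> n"
    and "n < t \<Longrightarrow> - \<psi> t \<le> char_lambda \<psi> n * right_deriv \<psi> t"
proof -
  show lam: "char_lambda \<psi> n = n * char_alpha \<psi> n"
    using n by (simp add: char_lambda_def char_alpha_def)
  have mono: "char_alpha \<psi> s \<le> char_alpha \<psi> n" "char_lambda \<psi> n \<le> char_lambda \<psi> s" if "n < s" for s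
    using that n dec inc
    by (auto simp: decreases_to_zero_def increases_to_infinity_def monotone_on_def)
  have pos: "0 < \<psi> s" "right_deriv \<psi> s < 0" "0 < char_alpha \<psi> s" if "n < s" for s
    using that n psi_class_right_derivative(2)[OF psi, of s] psi
    by (auto simp: psi_class_def char_alpha_def intro!: divide_pos_neg mult_pos_neg)
  show alpha: "0 < char_alpha \<psi> n" using pos(3)[of "n + 1"] mono(1)[of "n + 1"] by linarith
  show "t * right_deriv \<psi> t \<le> - \<psi> t / char_alpha \<psi> n" if t: "n < t"
  proof -
    have "\<psi> t / (t * \<bar>right_deriv \<psi> t\<bar>) \<le> char_alpha \<psi> n"
      using mono(1)[OF t] by (simp add: char_alpha_def[of _ t])
    then have "\<psi> t \<le> char_alpha \<psi> n * (t * - right_deriv \<psi> t)"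
      using pos[OF t] t n by (subst (asm) pos_divide_le_eq) (auto intro!: mult_pos_neg)
    then show ?thesis using alpha
      by (simp only: minus_divide_left[symmetric] pos_le_divide_eq) (simp add: field_simps)
  qed
  show "- \<psi> t \<le> char_lambda \<psi> n * right_deriv \<psi> t" if t: "n < t"
  proof -
    have "char_lambda \<psi> n \<le> \<psi> t / \<bar>right_deriv \<psi> t\<bar>"
      using mono(2)[OF t] by (simp add: char_lambda_def[of _ t])
    then show ?thesis using pos[OF t] by (simp add: field_simps)
  qed
qed

text \<open>The growth bound on the unit interval \<open>[a, a + 1]\<close> turns a pointwise estimate of the product rule
  into one step of a telescoping sum.\<close>

lemma multiplier_step:
  assumes psi: "\<psi> \<in> \<MM>" and a: "1 \<le> a"
    and p: "\<And>t. (p has_real_derivative p' t) (at t)"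
    and le: "\<And>t. a < t \<Longrightarrow> t < a + 1 \<Longrightarrow> p' t * \<psi> t + p t * right_deriv \<psi> t \<le> - m"
  shows "m \<le> p a * \<psi> a - p (a + 1) * \<psi> (a + 1)"
proof -
  have "p (a + 1) * \<psi> (a + 1) - p a * \<psi> a \<le> - m * (a + 1 - a)"
  proof (rule right_deriv_bound_imp_growth_bound)
    show "continuous_on {a..a + 1} (\<lambda>t. p t * \<psi> t)"
      using psi a p by (intro continuous_on_mult DERIV_continuous_on[of _ p p'])
        (auto simp: psi_class_def intro: continuous_on_subset has_field_derivative_at_within)
    show "\<exists>D\<le>- m. ((\<lambda>t. p t * \<psi> t) has_real_derivative D) (at_right t)"
      if t: "a < t" "t < a + 1" for t
    proof (intro exI conjI)
      show "((\<lambda>t. p t * \<psi> t) has_real_derivative p' t * \<psi> t + p t * right_deriv \<psi> t) (at_right t)"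
        using DERIV_mult'[OF has_field_derivative_at_within[OF p]
            psi_class_right_derivative(1)[OF psi, of t]] t a by (simp add: add.commute)
    qed (rule le[OF t])
  qed simp
  then show ?thesis by simp
qed

lemma telescoping_sum_le:
  fixes f K :: "nat \<Rightarrow> real"
  assumes "\<And>j. 0 \<le> f j" "\<And>j. 0 \<le> K j" "\<And>j. f j \<le> K j - K (Suc j)"
  shows "summable f" and "suminf f \<le> K 0"
proof -
  have "(\<Sum>j<m. f j) \<le> K 0" for m
  proof -
    have "(\<Sum>j<m. f j) \<le> (\<Sum>j<m. K j - K (Suc j))" by (intro sum_mono assms)
    also have "\<dots> = K 0 - K m" by (rule sum_lessThan_telescope')
    finally show ?thesis using assms(2)[of m] by simp
  qed
  then show "summable f" and "suminf f \<le> K 0"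
    using assms(1) by (auto intro!: summableI_nonneg_bounded suminf_le_const)
qed

text \<open>With \<open>r = 1/\<alpha>(n)\<close> the multipliers are \<open>t/(r - 1)\<close> for the upper bound of the sum, the constant
  \<open>-\<lambda>(n)\<close> for its lower bound, and a quadratic for the first moment; in each case the multiplier is
  the one for which equality holds for the pure power \<open>t powr - r\<close>, respectively the exponential
  with constant \<open>\<lambda>\<close>.\<close>

lemma tail_sums:
  fixes n :: nat
  assumes psi: "\<psi> \<in> \<MM>"
    and dec: "decreases_to_zero (char_alpha \<psi>)" and inc: "increases_to_infinity (char_lambda \<psi>)"
    and n: "1 \<le> n" and small: "char_alpha \<psi> n < 1 / 4"
  defines "\<alpha> \<equiv> char_alpha \<psi> n" and "\<Lambda> \<equiv> char_lambda \<psi> n"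
  shows "summable (\<lambda>j. \<psi> (real (n + j)))"
    and "(\<Sum>j. \<psi> (real (n + j))) \<le> \<psi> n * \<Lambda> * (1 + 1 / \<Lambda> + 4 / 3 * \<alpha>)"
    and "\<psi> n * \<Lambda> \<le> (\<Sum>j. \<psi> (real (n + j)))"
    and "summable (\<lambda>j. real j * \<psi> (real (n + j)))"
    and "(\<Sum>j. real j * \<psi> (real (n + j))) \<le> 4 / 3 * \<psi> n * \<Lambda> * (1 + 2 * \<Lambda>)"
proof -
  have pos: "0 < \<psi> t" if "1 \<le> t" for t using psi that by (simp add: psi_class_def)
  have alpha: "0 < \<alpha>" "\<alpha> < 1 / 4" and lambda: "\<Lambda> = n * \<alpha>"
    using characteristic_bounds[OF psi dec inc, of "real n"] n small by (auto simp: \<alpha>_def \<Lambda>_def)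
  have lambda_pos: "0 < \<Lambda>" using alpha n by (simp add: lambda)
  define r where "r = 1 / \<alpha>"
  have r: "4 < r" using alpha by (simp add: r_def field_simps)
  have decay: "t * right_deriv \<psi> t \<le> - r * \<psi> t" if "real n < t" for t
    using characteristic_bounds(3)[OF psi dec inc, of "real n" t] n that by (simp add: r_def \<alpha>_def)
  have mono: "\<psi> (real (n + Suc j)) \<le> \<psi> t" "\<psi> t \<le> \<psi> (real (n + j))"
    if "real (n + j) < t" "t < real (n + j) + 1" for j and t :: real
    using that n by (auto intro!: psi_class_antimono[OF psi])

  have step1: "\<psi> (real (n + Suc j)) \<le> real (n + j) / (r - 1) * \<psi> (real (n + j))
      - real (n + Suc j) / (r - 1) * \<psi> (real (n + Suc j))" for j
  proof -
    have "\<psi> (real (n + Suc j)) \<le> real (n + j) / (r - 1) * \<psi> (real (n + j))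
      - (real (n + j) + 1) / (r - 1) * \<psi> (real (n + j) + 1)"
    proof (rule multiplier_step[OF psi, where p' = "\<lambda>t. 1 / (r - 1)"])
      show "((\<lambda>t. t / (r - 1)) has_real_derivative 1 / (r - 1)) (at t)" for t
        using r by (auto intro!: derivative_eq_intros)
      fix t assume t: "real (n + j) < t" "t < real (n + j) + 1"
      have "1 / (r - 1) * \<psi> t + t / (r - 1) * right_deriv \<psi> t
        = (\<psi> t + t * right_deriv \<psi> t) / (r - 1)"
        by (simp add: add_divide_distrib)
      also have "\<dots> \<le> (\<psi> t - r * \<psi> t) / (r - 1)"
        using decay[of t] t r by (intro divide_right_mono) auto
      also have "\<dots> = - \<psi> t" using r by (simp add: field_simps)
      finally show "1 / (r - 1) * \<psi> t + t / (r - 1) * right_deriv \<psi> t \<le> - \<psi> (real (n + Suc j))"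
        using mono(1)[of j t, OF t] by simp
    qed (use n in auto)
    then show ?thesis by (simp add: add_ac)
  qed
  have sum1: "summable (\<lambda>j. \<psi> (real (n + Suc j)))"
    "(\<Sum>j. \<psi> (real (n + Suc j))) \<le> real (n + 0) / (r - 1) * \<psi> (real (n + 0))"
    using telescoping_sum_le[of "\<lambda>j. \<psi> (real (n + Suc j))"
        "\<lambda>j. real (n + j) / (r - 1) * \<psi> (real (n + j))"] step1 r n pos
    by (auto simp: less_imp_le)
  then show summable: "summable (\<lambda>j. \<psi> (real (n + j)))"
    using summable_Suc_iff[of "\<lambda>j. \<psi> (real (n + j))"] by simp
  have "n / (r - 1) = \<Lambda> / (1 - \<alpha>)" using alpha by (simp add: r_def lambda field_simps)
  also have "\<dots> \<le> \<Lambda> * (1 + 4 / 3 * \<alpha>)"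
  proof -
    have "1 \<le> (1 + 4 / 3 * \<alpha>) * (1 - \<alpha>)"
      using mult_left_mono[of \<alpha> "1/4" \<alpha>] alpha by (simp add: algebra_simps)
    then have "\<Lambda> * 1 \<le> \<Lambda> * ((1 + 4 / 3 * \<alpha>) * (1 - \<alpha>))"
      using lambda_pos by (intro mult_left_mono) auto
    then show ?thesis using alpha by (simp add: pos_divide_le_eq mult.assoc)
  qed
  finally have "n / (r - 1) * \<psi> n \<le> \<Lambda> * (1 + 4 / 3 * \<alpha>) * \<psi> n"
    using pos[of n] n by (intro mult_right_mono) auto
  then show "(\<Sum>j. \<psi> (real (n + j))) \<le> \<psi> n * \<Lambda> * (1 + 1 / \<Lambda> + 4 / 3 * \<alpha>)"
    using sum1(2) suminf_split_head[OF summable] lambda_pos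
    by (simp add: algebra_simps)

  have step2: "\<Lambda> * \<psi> (real (n + j)) - \<Lambda> * \<psi> (real (n + Suc j)) \<le> \<psi> (real (n + j))" for j
  proof -
    have "- \<psi> (real (n + j)) \<le> - \<Lambda> * \<psi> (real (n + j)) - (- \<Lambda>) * \<psi> (real (n + j) + 1)"
    proof (rule multiplier_step[OF psi, where p' = "\<lambda>t. 0"])
      fix t assume t: "real (n + j) < t" "t < real (n + j) + 1"
      show "0 * \<psi> t + - \<Lambda> * right_deriv \<psi> t \<le> - (- \<psi> (real (n + j)))"
        using characteristic_bounds(4)[OF psi dec inc, of "real n" t] mono(2)[of j t, OF t] t n
        by (simp add: \<Lambda>_def)
    qed (use n in auto)
    then show ?thesis by (simp add: add_ac)
  qed
  have "(\<lambda>m. \<psi> (real (n + m))) \<longlonglongrightarrow> 0"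
    by (rule summable_LIMSEQ_zero[OF summable])
  then have "(\<lambda>m. \<Lambda> * \<psi> n - \<Lambda> * \<psi> (real (n + m))) \<longlonglongrightarrow> \<Lambda> * \<psi> n - \<Lambda> * 0"
    by (intro tendsto_intros)
  moreover have "\<Lambda> * \<psi> n - \<Lambda> * \<psi> (real (n + m)) \<le> (\<Sum>j<m. \<psi> (real (n + j)))" for m
  proof -
    have "\<Lambda> * \<psi> n - \<Lambda> * \<psi> (real (n + m))
        = (\<Sum>j<m. \<Lambda> * \<psi> (real (n + j)) - \<Lambda> * \<psi> (real (n + Suc j)))"
      using sum_lessThan_telescope'[of "\<lambda>j. \<Lambda> * \<psi> (real (n + j))" m] by simp
    also have "\<dots> \<le> (\<Sum>j<m. \<psi> (real (n + j)))"
      by (intro sum_mono step2)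
    finally show ?thesis .
  qed
  ultimately show "\<psi> n * \<Lambda> \<le> (\<Sum>j. \<psi> (real (n + j)))"
    using LIMSEQ_le[OF _ summable_LIMSEQ[OF summable]] by (fastforce simp: mult.commute)

  \<comment> \<open>The summand \<open>(j + 1) \<psi> (n + j + 1)\<close> is compared with \<open>(t - n + 1) \<psi> t\<close> on the preceding unit
    interval; the coefficient \<open>B\<close> of the linear term is chosen to absorb \<open>n/(r - 2)\<close> and the extra \<open>1\<close>.\<close>
  define B where "B = (n / (r - 2) + 1) / (r - 1)"
  define p where "p t = t * (t - n) / (r - 2) + B * t" for t :: real
  have B: "0 \<le> B" using r by (simp add: B_def)
  have step3: "Suc j * \<psi> (real (n + Suc j)) \<le> p (real (n + j)) * \<psi> (real (n + j))
      - p (real (n + Suc j)) * \<psi> (real (n + Suc j))" for j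
  proof -
    have "Suc j * \<psi> (real (n + Suc j)) \<le> p (real (n + j)) * \<psi> (real (n + j))
      - p (real (n + j) + 1) * \<psi> (real (n + j) + 1)"
    proof (rule multiplier_step[OF psi, where p' = "\<lambda>t. (2 * t - real n) / (r - 2) + B"])
      show "(p has_real_derivative (2 * t - n) / (r - 2) + B) (at t)" for t :: real
        unfolding p_def using r by (auto intro!: derivative_eq_intros)
      fix t assume t: "real (n + j) < t" "t < real (n + j) + 1"
      have "((2 * t - n) / (r - 2) + B) * \<psi> t + p t * right_deriv \<psi> t
        = ((2 * t - n) / (r - 2) + B) * \<psi> t + ((t - n) / (r - 2) + B) * (t * right_deriv \<psi> t)"
        by (simp add: p_def algebra_simps)
      also have "\<dots> \<le> ((2 * t - n) / (r - 2) + B) * \<psi> t + ((t - n) / (r - 2) + B) * (- r * \<psi> t)"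
        using decay[of t] t r B by (intro add_left_mono mult_left_mono) auto
      also have "\<dots> = - ((t - n + 1) * \<psi> t)"
      proof -
        define X Y where "X = (t - n) / (r - 2)" and "Y = n / (r - 2)"
        have "X * (r - 2) = t - n" "B * (r - 1) = Y + 1" "(2 * t - n) / (r - 2) = 2 * X + Y"
          using r by (simp_all add: X_def Y_def B_def add_divide_distrib[symmetric])
        then show ?thesis unfolding X_def[symmetric] by algebra
      qed
      also have "\<dots> \<le> - (Suc j * \<psi> (real (n + Suc j)))"
        using mono(1)[of j t, OF t] t pos[of "real (n + Suc j)"] n by (auto intro!: mult_mono)
      finally show "((2 * t - n) / (r - 2) + B) * \<psi> t + p t * right_deriv \<psi> t
        \<le> - (Suc j * \<psi> (real (n + Suc j)))" .
    qed (use n in auto)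
    then show ?thesis by (simp add: add_ac)
  qed
  have sum3: "summable (\<lambda>j. real (Suc j) * \<psi> (real (n + Suc j)))"
    "(\<Sum>j. real (Suc j) * \<psi> (real (n + Suc j))) \<le> p (real (n + 0)) * \<psi> (real (n + 0))"
    using telescoping_sum_le[of "\<lambda>j. real (Suc j) * \<psi> (real (n + Suc j))"
        "\<lambda>j. p (real (n + j)) * \<psi> (real (n + j))"] step3 r n pos B
    by (auto simp: less_imp_le p_def)
  then show summable': "summable (\<lambda>j. real j * \<psi> (real (n + j)))"
    using summable_Suc_iff[of "\<lambda>j. real j * \<psi> (real (n + j))"] by simp
  have "p n = \<Lambda> / (1 - \<alpha>) * (1 + \<Lambda> / (1 - 2 * \<alpha>))"
    using alpha by (simp add: p_def B_def r_def lambda divide_simps)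
  also have "\<dots> \<le> (4 / 3 * \<Lambda>) * (1 + 2 * \<Lambda>)"
    using alpha lambda_pos by (intro mult_mono add_mono) (auto simp: field_simps)
  finally have "p n * \<psi> n \<le> (4 / 3 * \<Lambda>) * (1 + 2 * \<Lambda>) * \<psi> n"
    using pos[of n] n by (intro mult_right_mono) auto
  then show "(\<Sum>j. real j * \<psi> (real (n + j))) \<le> 4 / 3 * \<psi> n * \<Lambda> * (1 + 2 * \<Lambda>)"
    using sum3(2) suminf_split_head[OF summable'] by (simp add: algebra_simps)
qed

section \<open>Integrals over a period\<close>

abbreviation period_int :: "(real \<Rightarrow> real) \<Rightarrow> real" where
  "period_int f \<equiv> (LINT t:{-pi..pi}|lebesgue. f t)"

text \<open>The space \<^term>\<open>L1_space\<close> and its norm refer to \<open>[0, 2\<pi>)\<close>, the convolutions and Fourier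
  coefficients to \<open>[-\<pi>, \<pi>]\<close>.\<close>

lemma periodic_has_integral_shift:
  assumes per: "periodic_2pi h" and int: "h integrable_on {0..2 * pi}"
  shows "(h has_integral integral {0..2 * pi} h) {-pi..pi}"
proof -
  have ints: "h integrable_on {0..pi}" "h integrable_on {pi..2 * pi}"
    using int by (auto intro: integrable_subinterval_real)
  have "((\<lambda>x. h (x + 2 * pi)) has_integral integral {pi..2 * pi} h) {pi - 2 * pi..2 * pi - 2 * pi}"
    by (intro has_integral_shift_real_ivl integrable_integral ints)
  then have "(h has_integral integral {pi..2 * pi} h) {-pi..0}"
    using per by (simp add: periodic_2pi_def)
  then have "(h has_integral integral {pi..2 * pi} h + integral {0..pi} h) {-pi..pi}"
    using integrable_integral[OF ints(1)] by (intro has_integral_combine[of "-pi" 0 pi]) auto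
  moreover have "integral {0..pi} h + integral {pi..2 * pi} h = integral {0..2 * pi} h"
    using int by (intro Henstock_Kurzweil_Integration.integral_combine) auto
  ultimately show ?thesis by (simp add: add.commute)
qed

lemma L1_space_period:
  assumes "\<phi> \<in> L1_space"
  shows "\<phi> absolutely_integrable_on {-pi..pi}" and "L1_norm \<phi> = period_int (\<lambda>t. \<bar>\<phi> t\<bar>)"
proof -
  have per: "periodic_2pi \<phi>" "periodic_2pi (\<lambda>t. \<bar>\<phi> t\<bar>)" and
    ai: "\<phi> absolutely_integrable_on {0..<2 * pi}"
    using assms by (auto simp: L1_space_def periodic_2pi_def)
  have neg: "negligible ({0..2 * pi} - {0..<2 * pi})"
    by (rule negligible_subset[of "{2 * pi}"]) auto
  have spike: "h integrable_on {0..<2 * pi} \<longleftrightarrow> h integrable_on {0..2 * pi}"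
    "integral {0..<2 * pi} h = integral {0..2 * pi} h" for h :: "real \<Rightarrow> real"
    by (intro integrable_spike_set_eq integral_spike_set negligible_subset[OF neg]; auto)+
  have "\<phi> integrable_on {0..2 * pi}" "(\<lambda>t. \<bar>\<phi> t\<bar>) integrable_on {0..2 * pi}"
    using ai by (auto simp: absolutely_integrable_on_def spike)
  note shift = this[THEN periodic_has_integral_shift[rotated]]
  show phi: "\<phi> absolutely_integrable_on {-pi..pi}"
    using shift per by (auto simp: absolutely_integrable_on_def)
  have "L1_norm \<phi> = integral {0..2 * pi} (\<lambda>t. \<bar>\<phi> t\<bar>)"
    unfolding L1_norm_def using set_integrable_abs[OF ai] by (simp add: set_lebesgue_integral_eq_integral spike)
  also have "\<dots> = integral {-pi..pi} (\<lambda>t. \<bar>\<phi> t\<bar>)"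
    using shift(2)[OF per(2)] by (simp add: integral_unique)
  finally show "L1_norm \<phi> = period_int (\<lambda>t. \<bar>\<phi> t\<bar>)"
    using set_integrable_abs[OF phi] by (simp add: set_lebesgue_integral_eq_integral)
qed

lemma continuous_periodic_in_L1:
  assumes "continuous_on UNIV g" "periodic_2pi g"
  shows "g \<in> L1_space"
proof -
  have "g absolutely_integrable_on {0..2 * pi}"
    by (intro absolutely_integrable_continuous_real continuous_on_subset[OF assms(1)]) auto
  then have "g absolutely_integrable_on {0..<2 * pi}"
    by (rule set_integrable_subset) auto
  with assms(2) show ?thesis by (simp add: L1_space_def)
qed

lemma continuous_period_int:
  assumes "continuous_on UNIV f" "(f has_integral I) {-pi..pi}"
  shows "period_int f = I"
proof -
  have "f absolutely_integrable_on {-pi..pi}"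
    by (intro absolutely_integrable_continuous_real continuous_on_subset[OF assms(1)]) auto
  then show ?thesis using assms(2) by (simp add: set_lebesgue_integral_eq_integral integral_unique)
qed

lemma absolutely_integrable_continuous_mult:
  assumes w: "continuous_on UNIV w" and phi: "\<phi> absolutely_integrable_on {-pi..pi}"
  shows "(\<lambda>t. w t * \<phi> t :: real) absolutely_integrable_on {-pi..pi}"
proof (rule absolutely_integrable_bounded_measurable_product_real[OF _ _ _ phi])
  have w': "continuous_on {-pi..pi} w" by (rule continuous_on_subset[OF w]) auto
  then show "w \<in> borel_measurable (lebesgue_on {-pi..pi})"
    by (intro continuous_imp_measurable_on_sets_lebesgue) auto
  show "bounded (w ` {-pi..pi})"
    by (intro compact_imp_bounded compact_continuous_image w') auto
qed auto

lemma period_int_series: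
  assumes w: "\<And>j. continuous_on UNIV (w j)" and M: "\<And>j t. \<bar>w j t\<bar> \<le> M j" "summable M"
    and phi: "\<phi> absolutely_integrable_on {-pi..pi}"
  shows "(\<lambda>t. (\<Sum>j. w j t) * \<phi> t) absolutely_integrable_on {-pi..pi}"
    and "(\<lambda>j. period_int (\<lambda>t. w j t * \<phi> t)) sums period_int (\<lambda>t. (\<Sum>j. w j t) * \<phi> t)"
proof -
  define F where "F j t = indicator {-pi..pi} t *\<^sub>R (w j t * \<phi> t)" for j t
  define A where "A t = indicator {-pi..pi} t *\<^sub>R \<bar>\<phi> t\<bar>" for t
  have intF: "integrable lebesgue (F j)" for j
    using absolutely_integrable_continuous_mult[OF w phi, of j] unfolding set_integrable_def F_def .
  have intA: "integrable lebesgue A"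
    using set_integrable_abs[OF phi] unfolding set_integrable_def A_def .
  have bound: "norm (F j t) \<le> M j * A t" for j t
    by (auto simp: F_def A_def abs_mult indicator_def intro!: mult_right_mono M)
  have w_sum: "summable (\<lambda>j. w j t)" for t
    by (rule summable_comparison_test'[OF M(2), of 0]) (use M(1) in auto)
  have AE: "AE t in lebesgue. summable (\<lambda>j. norm (F j t))"
    by (rule AE_I2, rule summable_comparison_test'[OF summable_mult2[OF M(2)], of 0])
      (use bound in auto)
  have norm_sum: "summable (\<lambda>j. LINT t|lebesgue. norm (F j t))"
  proof (rule summable_comparison_test'[OF summable_mult2[OF M(2)], of 0])
    fix j
    have "(LINT t|lebesgue. norm (F j t)) \<le> (LINT t|lebesgue. M j * A t)"
      by (intro integral_mono integrable_norm intF integrable_mult_right intA bound)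
    then show "norm (LINT t|lebesgue. norm (F j t)) \<le> M j * integral\<^sup>L lebesgue A"
      by simp
  qed
  have F_sum: "(\<lambda>t. \<Sum>j. F j t) = (\<lambda>t. indicator {-pi..pi} t *\<^sub>R ((\<Sum>j. w j t) * \<phi> t))"
  proof
    show "(\<Sum>j. F j t) = indicator {-pi..pi} t *\<^sub>R ((\<Sum>j. w j t) * \<phi> t)" for t
      unfolding F_def using suminf_mult2[OF w_sum, of t "\<phi> t"] by (simp add: indicator_def)
  qed
  show "(\<lambda>t. (\<Sum>j. w j t) * \<phi> t) absolutely_integrable_on {-pi..pi}"
    using integrable_suminf[OF intF AE norm_sum] unfolding F_sum set_integrable_def .
  show "(\<lambda>j. period_int (\<lambda>t. w j t * \<phi> t)) sums period_int (\<lambda>t. (\<Sum>j. w j t) * \<phi> t)"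
    using sums_integral[OF intF AE norm_sum] unfolding F_sum
    unfolding set_lebesgue_integral_def F_def .
qed

section \<open>Fourier coefficients of absolutely convergent series\<close>

lemma cos_has_integral_period:
  assumes "m \<noteq> (0::int)"
  shows "((\<lambda>t. cos (of_int m * t + c)) has_integral 0) {-pi..pi}"
proof -
  have "((\<lambda>t. cos (of_int m * t + c)) has_integral
      (sin (of_int m * pi + c) / of_int m - sin (of_int m * (-pi) + c) / of_int m)) {-pi..pi}"
    by (rule fundamental_theorem_of_calculus)
      (use assms in \<open>auto intro!: derivative_eq_intros
        simp: has_real_derivative_iff_has_vector_derivative[symmetric]\<close>)
  moreover have "sin (of_int m * pi + c) = sin (of_int m * (-pi) + c)"
    by (simp add: sin_add sin_diff sin_times_pi_eq_0)
  ultimately show ?thesis by simp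
qed

text \<open>Arbitrary phases let one statement cover products of cosines and of sines.\<close>

lemma cos_orthogonality:
  fixes k l :: nat
  assumes "k + l > 0"
  shows "((\<lambda>t. cos (k * t + c) * cos (l * t + d)) has_integral (if k = l then pi * cos (c - d) else 0))
    {-pi..pi}"
proof -
  have eq: "cos (k * t + c) * cos (l * t + d) =
     1 / 2 * (cos (of_int (int k - int l) * t + (c - d)) + cos (of_int (int k + int l) * t + (c + d)))" for t :: real
    by (simp add: cos_times_cos algebra_simps)
  have "((\<lambda>t. cos (of_int (int k - int l) * t + (c - d))) has_integral
      (if k = l then 2 * pi * cos (c - d) else 0)) {-pi..pi}"
  proof (cases "k = l")
    case True
    then show ?thesis using has_integral_const_real[of "cos (c - d)" "-pi" pi] by simp
  next
    case False
    then show ?thesis using cos_has_integral_period[of "int k - int l"] by simp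
  qed
  moreover have "((\<lambda>t. cos (of_int (int k + int l) * t + (c + d))) has_integral 0) {-pi..pi}"
    by (rule cos_has_integral_period) (use assms in linarith)
  ultimately have "((\<lambda>t. 1 / 2 * (cos (of_int (int k - int l) * t + (c - d)) +
      cos (of_int (int k + int l) * t + (c + d)))) has_integral
      1 / 2 * ((if k = l then 2 * pi * cos (c - d) else 0) + 0)) {-pi..pi}"
    by (intro has_integral_mult_right has_integral_add)
  then show ?thesis unfolding eq by (cases "k = l") auto
qed

lemma sin_as_cos: "sin x = cos (x + - (pi / 2))" for x :: real
  by (simp add: cos_diff)

text \<open>Integrating against \<open>cos (k t + \<theta>)\<close> with \<open>\<theta> = 0\<close> and \<open>\<theta> = -\<pi>/2\<close> gives the cosine and the sine
  coefficients by a single termwise integration.\<close>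

lemma fourier_coeff_series:
  assumes f: "\<And>x. f x = a0 / 2 + (\<Sum>j. c (Suc j) * cos (real (Suc j) * x) + d (Suc j) * sin (real (Suc j) * x))"
    and M: "summable M" "\<And>j. \<bar>c (Suc j)\<bar> + \<bar>d (Suc j)\<bar> \<le> M j"
  shows "fourier_cos_coeff f 0 = a0"
    and "k \<ge> 1 \<Longrightarrow> fourier_cos_coeff f k = c k"
    and "k \<ge> 1 \<Longrightarrow> fourier_sin_coeff f k = d k"
proof -
  define w where "w j t = c (Suc j) * cos (real (Suc j) * t) + d (Suc j) * sin (real (Suc j) * t)" for j t
  have w: "continuous_on UNIV (w j)" for j
    unfolding w_def by (intro continuous_intros)
  have bound: "\<bar>w j t\<bar> \<le> M j" for j t
  proof -
    have "\<bar>w j t\<bar> \<le> \<bar>c (Suc j)\<bar> * 1 + \<bar>d (Suc j)\<bar> * 1"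
      unfolding w_def
      by (intro order_trans[OF abs_triangle_ineq] add_mono) (auto simp: abs_mult intro!: mult_left_le)
    with M(2)[of j] show ?thesis by simp
  qed
  have main: "period_int (\<lambda>t. f t * cos (real k * t + \<theta>)) =
      a0 / 2 * period_int (\<lambda>t. cos (real k * t + \<theta>)) +
      (if k = 0 then 0 else pi * (c k * cos \<theta> - d k * sin \<theta>))" (is "?L = ?R") for k \<theta>
  proof -
    have e: "(\<lambda>t. cos (real k * t + \<theta>)) absolutely_integrable_on {-pi..pi}"
      by (intro absolutely_integrable_continuous_real continuous_intros)
    have coeff: "period_int (\<lambda>t. w j t * cos (real k * t + \<theta>)) =
        (if j = k - 1 then if k = 0 then 0 else pi * (c k * cos \<theta> - d k * sin \<theta>) else 0)" for j
    proof (rule continuous_period_int)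
      show "continuous_on UNIV (\<lambda>t. w j t * cos (real k * t + \<theta>))"
        by (intro continuous_intros w)
      have "((\<lambda>t. c (Suc j) * (cos (real (Suc j) * t + 0) * cos (real k * t + \<theta>)) +
          d (Suc j) * (cos (real (Suc j) * t + - (pi / 2)) * cos (real k * t + \<theta>))) has_integral
          c (Suc j) * (if Suc j = k then pi * cos (0 - \<theta>) else 0) +
          d (Suc j) * (if Suc j = k then pi * cos (- (pi / 2) - \<theta>) else 0)) {-pi..pi}"
        by (intro has_integral_add has_integral_mult_right cos_orthogonality) auto
      moreover have "cos (- (pi / 2) - \<theta>) = - sin \<theta>" by (simp add: cos_diff)
      ultimately show "((\<lambda>t. w j t * cos (real k * t + \<theta>)) has_integral
        (if j = k - 1 then if k = 0 then 0 else pi * (c k * cos \<theta> - d k * sin \<theta>) else 0)) {-pi..pi}"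
        unfolding sin_as_cos[symmetric] by (cases "Suc j = k") (auto simp: w_def algebra_simps)
    qed
    have "(\<lambda>j. period_int (\<lambda>t. w j t * cos (real k * t + \<theta>))) sums
        period_int (\<lambda>t. (\<Sum>j. w j t) * cos (real k * t + \<theta>))"
      by (rule period_int_series(2)[OF w bound M(1) e])
    then have ser: "period_int (\<lambda>t. (\<Sum>j. w j t) * cos (real k * t + \<theta>)) =
        (if k = 0 then 0 else pi * (c k * cos \<theta> - d k * sin \<theta>))"
      unfolding coeff using sums_single[of "k - 1" "\<lambda>_. if k = 0 then 0 else pi * (c k * cos \<theta> - d k * sin \<theta>)"]
      by (rule sums_unique2)
    have "?L = period_int (\<lambda>t. a0 / 2 * cos (real k * t + \<theta>) + (\<Sum>j. w j t) * cos (real k * t + \<theta>))"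
      by (simp add: f w_def distrib_right)
    also have "\<dots> = ?R"
      unfolding ser[symmetric] 
      using set_integral_add(2)[OF set_integrable_mult_right[of "a0 / 2", OF e]
          period_int_series(1)[OF w bound M(1) e]] by simp
    finally show ?thesis .
  qed
  have int: "period_int (\<lambda>t. cos (real k * t + \<theta>)) = 0" if "k \<ge> 1" for k \<theta>
    using that cos_has_integral_period[of "int k" \<theta>]
    by (intro continuous_period_int continuous_intros) auto
  have "period_int (\<lambda>t. cos (real 0 * t + 0)) = 2 * pi"
    using has_integral_const_real[of "1 :: real" "-pi" pi]
    by (intro continuous_period_int) auto
  then show "fourier_cos_coeff f 0 = a0"
    using main[of 0 0] by (simp add: fourier_cos_coeff_def)
  show "fourier_cos_coeff f k = c k" if "k \<ge> 1"
    using main[of k 0] int[of k 0] that by (simp add: fourier_cos_coeff_def)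
  show "fourier_sin_coeff f k = d k" if "k \<ge> 1"
    using main[of k "- (pi / 2)"] int[of k "- (pi / 2)"] that
    unfolding sin_as_cos[symmetric] by (simp add: fourier_sin_coeff_def)
qed

section \<open>Best approximation in the mean\<close>

lemma trig_poly_continuous_periodic:
  assumes "p \<in> trig_polys m"
  shows "continuous_on UNIV p" and "periodic_2pi p"
proof -
  obtain a b where p: "p = (\<lambda>x. a 0 / 2 + (\<Sum>k=1..m. a k * cos (real k * x) + b k * sin (real k * x)))"
    using assms by (auto simp: trig_polys_def)
  show "continuous_on UNIV p" unfolding p by (intro continuous_intros)
  have "cos (real k * (x + 2 * pi)) = cos (real k * x)" "sin (real k * (x + 2 * pi)) = sin (real k * x)" for k x
    by (simp_all add: distrib_left cos_add sin_add sin_times_pi_eq_0 mult.assoc[symmetric] mult.commute[of _ 2])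
  then show "periodic_2pi p" by (simp add: periodic_2pi_def p)
qed

lemma trig_poly_orthogonal:
  fixes k m :: nat
  assumes p: "p \<in> trig_polys m" and k: "m < k"
  shows "period_int (\<lambda>t. cos (real k * t + c) * p t) = 0"
proof (rule continuous_period_int)
  show "continuous_on UNIV (\<lambda>t. cos (real k * t + c) * p t)"
    by (intro continuous_intros trig_poly_continuous_periodic(1)[OF p])
  obtain a b where p_eq: "p = (\<lambda>x. a 0 / 2 + (\<Sum>l=1..m. a l * cos (real l * x) + b l * sin (real l * x)))"
    using p by (auto simp: trig_polys_def)
  have l: "((\<lambda>t. cos (real k * t + c) * cos (real l * t + d)) has_integral 0) {-pi..pi}" if "l \<le> m" for l :: nat and d
    using cos_orthogonality[of k l c d] that k by simp
  have "((\<lambda>t. a 0 / 2 * (cos (real k * t + c) * cos (real 0 * t + 0)) +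
      (\<Sum>l=1..m. a l * (cos (real k * t + c) * cos (real l * t + 0)) +
        b l * (cos (real k * t + c) * cos (real l * t + - (pi / 2))))) has_integral
      a 0 / 2 * 0 + (\<Sum>l=1..m. a l * 0 + b l * 0)) {-pi..pi}"
    by (intro has_integral_add has_integral_mult_right has_integral_sum l) auto
  then show "((\<lambda>t. cos (real k * t + c) * p t) has_integral 0) {-pi..pi}"
    unfolding sin_as_cos[symmetric] p_eq by (simp add: distrib_left sum_distrib_left mult_ac)
qed

lemma L1_norm_nonneg: "0 \<le> L1_norm f"
  unfolding L1_norm_def set_lebesgue_integral_def by (intro Bochner_Integration.integral_nonneg) auto

lemma trig_polys_nonempty: "trig_polys m \<noteq> {}"
  by (auto simp: trig_polys_def)

lemma best_approx_L1_le: "p \<in> trig_polys (n - 1) \<Longrightarrow> best_approx_L1 n g \<le> L1_norm (\<lambda>x. g x - p x)"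
  unfolding best_approx_L1_def
  by (rule cINF_lower) (auto intro: bdd_belowI2[of _ 0] L1_norm_nonneg)

lemma best_approx_L1_geI:
  "(\<And>p. p \<in> trig_polys (n - 1) \<Longrightarrow> B \<le> L1_norm (\<lambda>x. g x - p x)) \<Longrightarrow> B \<le> best_approx_L1 n g"
  unfolding best_approx_L1_def by (rule cINF_greatest[OF trig_polys_nonempty])

lemma best_approx_L1_nonneg: "0 \<le> best_approx_L1 n g"
  by (rule best_approx_L1_geI) (rule L1_norm_nonneg)

lemma best_approx_L1_affine_le:
  assumes s: "0 < s"
  shows "best_approx_L1 n (\<lambda>x. s * (g x - c)) \<le> s * best_approx_L1 n g"
proof -
  have "best_approx_L1 n (\<lambda>x. s * (g x - c)) / s \<le> best_approx_L1 n g"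
  proof (rule best_approx_L1_geI)
    fix p assume "p \<in> trig_polys (n - 1)"
    then obtain a b where p: "p = (\<lambda>x. a 0 / 2 + (\<Sum>k=1..n - 1. a k * cos (real k * x) + b k * sin (real k * x)))"
      by (auto simp: trig_polys_def)
    have "(\<lambda>x. s * (p x - c)) = (\<lambda>x. (s * a 0 - 2 * s * c) / 2 +
        (\<Sum>k=1..n - 1. (if k = 0 then s * a 0 - 2 * s * c else s * a k) * cos (real k * x) + s * b k * sin (real k * x)))"
    proof
      fix x
      have "(\<Sum>k=1..n - 1. (if k = 0 then s * a 0 - 2 * s * c else s * a k) * cos (real k * x) + s * b k * sin (real k * x))
        = s * (\<Sum>k=1..n - 1. a k * cos (real k * x) + b k * sin (real k * x))"
        unfolding sum_distrib_left by (rule sum.cong) (auto simp: algebra_simps)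
      then show "s * (p x - c) = (s * a 0 - 2 * s * c) / 2 +
        (\<Sum>k=1..n - 1. (if k = 0 then s * a 0 - 2 * s * c else s * a k) * cos (real k * x) + s * b k * sin (real k * x))"
        by (simp add: p field_simps)
    qed
    then have "(\<lambda>x. s * (p x - c)) \<in> trig_polys (n - 1)"
      unfolding trig_polys_def
      by (intro CollectI exI[of _ "\<lambda>k. if k = 0 then s * a 0 - 2 * s * c else s * a k"] exI[of _ "\<lambda>k. s * b k"]) simp
    then have "best_approx_L1 n (\<lambda>x. s * (g x - c)) \<le> L1_norm (\<lambda>x. s * (g x - c) - s * (p x - c))"
      by (rule best_approx_L1_le)
    also have "\<dots> = L1_norm (\<lambda>x. s * (g x - p x))" by (simp add: algebra_simps)
    also have "\<dots> = s * L1_norm (\<lambda>x. g x - p x)"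
      using s by (simp add: L1_norm_def abs_mult)
    finally show "best_approx_L1 n (\<lambda>x. s * (g x - c)) / s \<le> L1_norm (\<lambda>x. g x - p x)"
      using s by (simp add: field_simps)
  qed
  then show ?thesis using s by (simp add: field_simps)
qed

text \<open>For positive \<open>s\<close>, the map \<open>p \<mapsto> s (p - c)\<close> permutes the trigonometric polynomials of a given order; the
  reverse inequality is the preceding one for the inverse map.\<close>

lemma best_approx_L1_affine:
  assumes s: "0 < s"
  shows "best_approx_L1 n (\<lambda>x. s * (g x - c)) = s * best_approx_L1 n g"
proof (rule antisym[OF best_approx_L1_affine_le[OF s]])
  have "best_approx_L1 n (\<lambda>x. 1 / s * (s * (g x - c) - (- s * c))) \<le> 1 / s * best_approx_L1 n (\<lambda>x. s * (g x - c))"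
    using s by (intro best_approx_L1_affine_le) simp
  then show "s * best_approx_L1 n g \<le> best_approx_L1 n (\<lambda>x. s * (g x - c))"
    using s by (simp add: field_simps)
qed

text \<open>The coefficient does not change when a polynomial of order below \<open>n\<close> is subtracted from \<open>\<phi>\<close>.\<close>

lemma coefficient_le_best_approx_L1:
  fixes k n :: nat
  assumes phi: "\<phi> \<in> L1_space" and k: "1 \<le> n" "n \<le> k"
  shows "\<bar>period_int (\<lambda>t. cos (real k * t + c) * \<phi> t)\<bar> \<le> best_approx_L1 n \<phi>"
proof (rule best_approx_L1_geI)
  fix p assume p: "p \<in> trig_polys (n - 1)"
  note p' = trig_poly_continuous_periodic[OF p]
  have "p \<in> L1_space" by (rule continuous_periodic_in_L1[OF p'])
  then have diff: "(\<lambda>t. \<phi> t - p t) \<in> L1_space"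
    using phi by (auto simp: L1_space_def periodic_2pi_def)
  have cos: "continuous_on UNIV (\<lambda>t. cos (real k * t + c))" by (intro continuous_intros)
  note int = absolutely_integrable_continuous_mult[OF cos L1_space_period(1)]
  have "period_int (\<lambda>t. cos (real k * t + c) * \<phi> t) - period_int (\<lambda>t. cos (real k * t + c) * p t)
      = period_int (\<lambda>t. cos (real k * t + c) * (\<phi> t - p t))"
    using set_integral_diff(2)[OF int[OF phi] int[OF \<open>p \<in> L1_space\<close>]] by (simp add: right_diff_distrib)
  moreover have "period_int (\<lambda>t. cos (real k * t + c) * p t) = 0"
    using k by (intro trig_poly_orthogonal[OF p]) auto
  ultimately have "\<bar>period_int (\<lambda>t. cos (real k * t + c) * \<phi> t)\<bar>
      = \<bar>period_int (\<lambda>t. cos (real k * t + c) * (\<phi> t - p t))\<bar>" by simp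
  also have "\<dots> \<le> period_int (\<lambda>t. \<bar>cos (real k * t + c) * (\<phi> t - p t)\<bar>)"
    using set_integral_norm_bound[OF int[OF diff]] by simp
  also have "\<dots> \<le> period_int (\<lambda>t. \<bar>\<phi> t - p t\<bar>)"
    by (intro set_integral_mono set_integrable_abs int[OF diff] L1_space_period(1)[OF diff])
      (auto simp: abs_mult intro!: mult_left_le_one_le)
  also have "\<dots> = L1_norm (\<lambda>t. \<phi> t - p t)" by (rule L1_space_period(2)[OF diff, symmetric])
  finally show "\<bar>period_int (\<lambda>t. cos (real k * t + c) * \<phi> t)\<bar> \<le> L1_norm (\<lambda>t. \<phi> t - p t)" .
qed

section \<open>The remainder of the Fourier sum\<close>

text \<open>Summability of \<open>\<psi>\<close> makes the kernel series uniformly convergent, so the convolution with \<open>\<phi>\<close> is an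
  absolutely convergent trigonometric series, whose Fourier sum is its partial sum.\<close>

lemma fourier_remainder_sums:
  assumes psi: "summable (\<lambda>j. \<psi> (real (Suc j)))" "\<And>j. 0 \<le> \<psi> (real (Suc j))"
    and f: "has_psi_beta_derivative \<psi> \<beta> f \<phi>" and n: "1 \<le> n"
  shows "(\<lambda>j. \<psi> (real (n + j)) / pi * period_int (\<lambda>t. cos (real (n + j) * (x - t) - \<beta> * pi / 2) * \<phi> t))
    sums (f x - fourier_sum (n - 1) f x)"
proof -
  obtain a0 where phi: "\<phi> \<in> L1_space"
    and f_eq: "\<And>x. f x = a0 / 2 + (1 / pi) * period_int (\<lambda>t. Psi_kernel \<psi> \<beta> (x - t) * \<phi> t)"
    using f by (auto simp: has_psi_beta_derivative_def)
  note ai = L1_space_period(1)[OF phi]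
  define \<gamma> where "\<gamma> = \<beta> * pi / 2"
  define A where "A = period_int (\<lambda>t. \<bar>\<phi> t\<bar>)"
  define c where "c k = \<psi> (real k) / pi * period_int (\<lambda>t. cos (real k * t + \<gamma>) * \<phi> t)" for k :: nat
  define d where "d k = \<psi> (real k) / pi * period_int (\<lambda>t. sin (real k * t + \<gamma>) * \<phi> t)" for k :: nat
  define u where "u k x = \<psi> (real k) / pi * period_int (\<lambda>t. cos (real k * (x - t) - \<gamma>) * \<phi> t)"
    for k :: nat and x
  have int: "(\<lambda>t. cos (real k * t + \<gamma>) * \<phi> t) absolutely_integrable_on {-pi..pi}"
    "(\<lambda>t. sin (real k * t + \<gamma>) * \<phi> t) absolutely_integrable_on {-pi..pi}" for k
    by (intro absolutely_integrable_continuous_mult[OF _ ai] continuous_intros)+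
  have u_eq: "u k x = c k * cos (real k * x) + d k * sin (real k * x)" for k x
  proof -
    have "period_int (\<lambda>t. cos (real k * (x - t) - \<gamma>) * \<phi> t) =
      period_int (\<lambda>t. cos (real k * x) * (cos (real k * t + \<gamma>) * \<phi> t) +
        sin (real k * x) * (sin (real k * t + \<gamma>) * \<phi> t))"
    proof (intro arg_cong[where f = period_int] ext)
      fix t
      have "cos (real k * (x - t) - \<gamma>) = cos (real k * x - (real k * t + \<gamma>))"
        by (simp add: algebra_simps)
      also have "\<dots> = cos (real k * x) * cos (real k * t + \<gamma>) + sin (real k * x) * sin (real k * t + \<gamma>)"
        by (rule cos_diff)
      finally show "cos (real k * (x - t) - \<gamma>) * \<phi> t =
        cos (real k * x) * (cos (real k * t + \<gamma>) * \<phi> t) +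
        sin (real k * x) * (sin (real k * t + \<gamma>) * \<phi> t)"
        by (simp add: algebra_simps)
    qed
    also have "\<dots> = cos (real k * x) * period_int (\<lambda>t. cos (real k * t + \<gamma>) * \<phi> t) +
        sin (real k * x) * period_int (\<lambda>t. sin (real k * t + \<gamma>) * \<phi> t)"
      by (subst set_integral_add(2)) (auto intro!: set_integrable_mult_right int)
    finally show ?thesis by (simp add: u_def c_def d_def algebra_simps)
  qed
  have u_sums: "(\<lambda>j. u (Suc j) x) sums (f x - a0 / 2)" for x
  proof -
    have "(\<lambda>j. period_int (\<lambda>t. \<psi> (real (Suc j)) * cos (real (Suc j) * (x - t) - \<gamma>) * \<phi> t)) sums
        period_int (\<lambda>t. (\<Sum>j. \<psi> (real (Suc j)) * cos (real (Suc j) * (x - t) - \<gamma>)) * \<phi> t)"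
      by (rule period_int_series(2)[where M = "\<lambda>j. \<psi> (real (Suc j))", OF _ _ psi(1) ai])
        (auto simp: abs_mult psi(2)[simplified] intro!: continuous_intros mult_left_le)
    from sums_mult[OF this, of "1 / pi"] show ?thesis
      by (simp add: f_eq u_def Psi_kernel_def \<gamma>_def mult.assoc)
  qed
  have bound: "\<bar>period_int (\<lambda>t. w t * \<phi> t)\<bar> \<le> A"
    if w: "continuous_on UNIV w" "\<And>t. \<bar>w t\<bar> \<le> 1" for w
  proof -
    note wi = absolutely_integrable_continuous_mult[OF w(1) ai]
    have "\<bar>period_int (\<lambda>t. w t * \<phi> t)\<bar> \<le> period_int (\<lambda>t. \<bar>w t * \<phi> t\<bar>)"
      using set_integral_norm_bound[OF wi] by simp
    also have "\<dots> \<le> A"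
      unfolding A_def by (intro set_integral_mono set_integrable_abs wi ai)
        (auto simp: abs_mult w intro!: mult_left_le_one_le)
    finally show ?thesis .
  qed
  have cd: "\<bar>c (Suc j)\<bar> + \<bar>d (Suc j)\<bar> \<le> \<psi> (real (Suc j)) * (2 * A / pi)" for j
  proof -
    have "\<bar>c (Suc j)\<bar> \<le> \<psi> (real (Suc j)) / pi * A" "\<bar>d (Suc j)\<bar> \<le> \<psi> (real (Suc j)) / pi * A"
      unfolding c_def d_def abs_mult using psi(2)[of j]
      by (intro mult_mono bound continuous_intros; simp)+
    then show ?thesis by (simp add: field_simps)
  qed
  have f_series: "f x = a0 / 2 + (\<Sum>j. c (Suc j) * cos (real (Suc j) * x) + d (Suc j) * sin (real (Suc j) * x))" for x
    using sums_unique[OF u_sums[of x]] by (simp add: u_eq)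
  note coeff = fourier_coeff_series[of f a0 c d, OF f_series summable_mult2[OF psi(1)] cd]
  have "fourier_sum (n - 1) f x = a0 / 2 + (\<Sum>k=1..n - 1. u k x)"
    by (simp add: fourier_sum_def coeff u_eq)
  also have "(\<Sum>k=1..n - 1. u k x) = (\<Sum>i<n - 1. u (Suc i) x)"
    by (simp add: sum.atLeast1_atMost_eq)
  finally have "(\<lambda>j. u (Suc (j + (n - 1))) x) sums (f x - fourier_sum (n - 1) f x)"
    using u_sums[of x] by (subst sums_iff_shift) simp
  moreover have "Suc (j + (n - 1)) = n + j" for j using n by simp
  ultimately show ?thesis by (simp only: u_def \<gamma>_def)
qed

lemma fourier_remainder_bound:
  fixes n :: nat
  assumes psi: "\<psi> \<in> \<MM>"
    and dec: "decreases_to_zero (char_alpha \<psi>)" and inc: "increases_to_infinity (char_lambda \<psi>)"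
    and n: "1 \<le> n" and small: "char_alpha \<psi> n < 1 / 4"
    and f: "has_psi_beta_derivative \<psi> \<beta> f \<phi>"
  shows "(\<lambda>j. \<psi> (real (n + j)) / pi * period_int (\<lambda>t. cos (real (n + j) * (x - t) - \<beta> * pi / 2) * \<phi> t))
    sums (f x - fourier_sum (n - 1) f x)" (is "?u sums ?R")
    and "\<bar>f x - fourier_sum (n - 1) f x\<bar> \<le> \<psi> n * char_lambda \<psi> n *
      (1 / pi + (1 / pi) / char_lambda \<psi> n + 4 / (3 * pi) * char_alpha \<psi> n) * best_approx_L1 n \<phi>"
proof -
  note tail = tail_sums[OF psi dec inc n small]
  have pos: "0 < \<psi> (real (Suc j))" for j using psi by (simp add: psi_class_def)
  have shift: "Suc (j + (n - 1)) = n + j" for j using n by simp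
  have "summable (\<lambda>j. \<psi> (real (Suc j)))"
    using tail(1) summable_iff_shift[of "\<lambda>j. \<psi> (real (Suc j))" "n - 1"] by (simp only: shift)
  then show sums: "?u sums ?R"
    using pos by (intro fourier_remainder_sums[OF _ _ f n]) (auto intro: less_imp_le)
  have phi: "\<phi> \<in> L1_space" using f by (simp add: has_psi_beta_derivative_def)
  have nonneg: "0 \<le> \<psi> (real (n + j)) / pi" for j
    using pos[of "j + (n - 1)"] unfolding shift by simp
  have bound: "norm (?u j) \<le> \<psi> (real (n + j)) * (best_approx_L1 n \<phi> / pi)" for j
  proof -
    have "cos (real (n + j) * (x - t) - \<beta> * pi / 2)
        = cos (real (n + j) * t + (\<beta> * pi / 2 - real (n + j) * x))" for t
      by (subst cos_minus[symmetric]) (simp add: algebra_simps)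
    then have "\<bar>period_int (\<lambda>t. cos (real (n + j) * (x - t) - \<beta> * pi / 2) * \<phi> t)\<bar> \<le> best_approx_L1 n \<phi>"
      using coefficient_le_best_approx_L1[OF phi n, of "n + j"] by simp
    then have "\<psi> (real (n + j)) / pi * \<bar>period_int (\<lambda>t. cos (real (n + j) * (x - t) - \<beta> * pi / 2) * \<phi> t)\<bar>
        \<le> \<psi> (real (n + j)) / pi * best_approx_L1 n \<phi>"
      using nonneg by (intro mult_left_mono)
    then show ?thesis using nonneg[of j] by (simp only: real_norm_def abs_mult abs_of_nonneg) simp
  qed
  have summ: "summable (\<lambda>j. \<psi> (real (n + j)) * (best_approx_L1 n \<phi> / pi))"
    by (rule summable_mult2[OF tail(1)])
  have "\<bar>?R\<bar> = norm (\<Sum>j. ?u j)" using sums_unique[OF sums] by simp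
  also have "\<dots> \<le> (\<Sum>j. norm (?u j))"
    by (rule summable_norm) (rule summable_comparison_test'[OF summ, of 0], use bound in auto)
  also have "\<dots> \<le> (\<Sum>j. \<psi> (real (n + j)) * (best_approx_L1 n \<phi> / pi))"
    by (intro suminf_le bound summ summable_comparison_test'[OF summ, of 0]) (use bound in auto)
  also have "\<dots> = (\<Sum>j. \<psi> (real (n + j))) * (best_approx_L1 n \<phi> / pi)"
    by (rule suminf_mult2[symmetric, OF tail(1)])
  also have "\<dots> \<le> \<psi> n * char_lambda \<psi> n * (1 + 1 / char_lambda \<psi> n + 4 / 3 * char_alpha \<psi> n)
      * (best_approx_L1 n \<phi> / pi)"
    by (intro mult_right_mono tail) (simp add: best_approx_L1_nonneg)
  also have "\<dots> = \<psi> n * char_lambda \<psi> n *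
      ((1 + 1 / char_lambda \<psi> n + 4 / 3 * char_alpha \<psi> n) / pi) * best_approx_L1 n \<phi>"
    by simp
  also have "(1 + 1 / char_lambda \<psi> n + 4 / 3 * char_alpha \<psi> n) / pi =
      1 / pi + (1 / pi) / char_lambda \<psi> n + 4 / (3 * pi) * char_alpha \<psi> n"
    by (simp add: add_divide_distrib)
  finally show "\<bar>?R\<bar> \<le> \<psi> n * char_lambda \<psi> n *
      (1 / pi + (1 / pi) / char_lambda \<psi> n + 4 / (3 * pi) * char_alpha \<psi> n) * best_approx_L1 n \<phi>" .
qed

section \<open>An extremal function\<close>

text \<open>Truncating \<open>cos t - cos \<epsilon>\<close> at zero yields a bump that is continuous and periodic by construction.\<close>

lemma bump_exists:
  assumes eps: "0 < \<epsilon>" "\<epsilon> < pi"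
  obtains g where "continuous_on UNIV g" "periodic_2pi g" "\<And>t. 0 \<le> g t" "period_int g = 1"
    "\<And>t. t \<in> {-pi..pi} \<Longrightarrow> g t \<noteq> 0 \<Longrightarrow> \<bar>t\<bar> \<le> \<epsilon>"
proof -
  define h where "h t = max 0 (cos t - cos \<epsilon>)" for t
  have cont: "continuous_on S h" for S
    unfolding h_def by (intro continuous_intros)
  have supp: "\<bar>t\<bar> \<le> \<epsilon>" if "t \<in> {-pi..pi}" "h t \<noteq> 0" for t
  proof (rule ccontr)
    assume "\<not> ?thesis"
    then have "cos \<bar>t\<bar> \<le> cos \<epsilon>" using that eps by (intro cos_monotone_0_pi_le) auto
    then show False using that by (simp add: h_def)
  qed
  have int: "h absolutely_integrable_on {-pi..pi}"
    by (intro absolutely_integrable_continuous_real cont)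
  have "cos \<epsilon> < cos (\<epsilon> / 2)" using eps by (intro cos_monotone_0_pi) auto
  then have "0 < integral {-pi..pi} h"
  proof -
    have "integral {-pi..pi} h \<noteq> 0"
    proof
      assume "integral {-pi..pi} h = 0"
      then have "\<forall>t\<in>{-pi..pi}. h t = 0"
        using integral_eq_0_iff[OF cont, of "-pi" pi] by (simp add: h_def)
      then have "h 0 = 0" by (rule bspec) simp
      then show False using cos_monotone_0_pi[of 0 \<epsilon>] eps by (simp add: h_def)
    qed
    moreover have "0 \<le> integral {-pi..pi} h"
      by (intro integral_nonneg) (auto simp: h_def intro: integrable_continuous_real cont)
    ultimately show ?thesis by simp
  qed
  then have pos: "0 < period_int h" using int by (simp add: set_lebesgue_integral_eq_integral)
  show thesis
  proof (rule that[of "\<lambda>t. 1 / period_int h * h t"])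
    show "period_int (\<lambda>t. 1 / period_int h * h t) = 1"
      using pos by (subst set_integral_mult_right) simp
  qed (use pos supp in \<open>auto simp: periodic_2pi_def h_def intro!: continuous_intros cont\<close>)
qed

lemma abs_cos_diff_le: "\<bar>cos x - cos y\<bar> \<le> \<bar>x - y\<bar>" for x y :: real
proof -
  have "\<bar>cos x - cos y\<bar> = 2 * (\<bar>sin ((x + y) / 2)\<bar> * \<bar>sin ((y - x) / 2)\<bar>)"
    by (simp add: cos_diff_cos abs_mult)
  also have "\<dots> \<le> 2 * (1 * \<bar>(y - x) / 2\<bar>)"
    by (intro mult_left_mono mult_mono abs_sin_x_le_abs_x) auto
  finally show ?thesis by simp
qed

text \<open>The bump acts almost like a point mass at \<open>0\<close>: on its support the phase varies by at most
  \<open>k \<epsilon>\<close>, and the cosine is Lipschitz with constant \<open>1\<close>.\<close>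

lemma bump_cos_coefficient_ge:
  fixes k :: nat and \<epsilon> :: real
  assumes g: "continuous_on UNIV g" "\<And>t. 0 \<le> g t" "period_int g = 1"
    and supp: "\<And>t. t \<in> {-pi..pi} \<Longrightarrow> g t \<noteq> 0 \<Longrightarrow> \<bar>t\<bar> \<le> \<epsilon>"
  shows "cos c - real k * \<epsilon> \<le> period_int (\<lambda>t. cos (real k * t + c) * g t)"
proof -
  have ai: "g absolutely_integrable_on {-pi..pi}"
    by (intro absolutely_integrable_continuous_real continuous_on_subset[OF g(1)]) auto
  have "period_int (\<lambda>t. (cos c - real k * \<epsilon>) * g t) \<le> period_int (\<lambda>t. cos (real k * t + c) * g t)"
  proof (intro set_integral_mono absolutely_integrable_continuous_mult ai)
    fix t assume t: "t \<in> {-pi..pi}"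
    show "(cos c - real k * \<epsilon>) * g t \<le> cos (real k * t + c) * g t"
    proof (cases "g t = 0")
      case False
      then have "real k * \<bar>t\<bar> \<le> real k * \<epsilon>" using supp[OF t] by (intro mult_left_mono) auto
      moreover have "\<bar>cos (real k * t + c) - cos c\<bar> \<le> real k * \<bar>t\<bar>"
        using abs_cos_diff_le[of "real k * t + c" c] by (simp add: abs_mult)
      ultimately show ?thesis using g(2)[of t] by (intro mult_right_mono) auto
    qed simp
  qed (intro continuous_intros)+
  then show ?thesis using g(3) by simp
qed

text \<open>The bump has mass one, so \<open>E\<^sub>n(g) \<le> 1\<close>, while its cosine coefficients of frequency near \<open>n\<close> are
  close to one; thus \<open>\<Phi>\<close> nearly attains the bound \<open>E\<^sub>n(\<Phi>)\<close> of all these coefficients at once. If the lower bound is negative there is nothing to prove;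
  otherwise only \<open>s \<ge> E\<close> is used of the scaling factor \<open>s\<close>.\<close>

lemma extremal_function:
  fixes n :: nat
  assumes psi: "\<psi> \<in> \<MM>"
    and dec: "decreases_to_zero (char_alpha \<psi>)" and inc: "increases_to_infinity (char_lambda \<psi>)"
    and n: "1 \<le> n" and small: "char_alpha \<psi> n < 1 / 4" and E: "0 < E"
  obtains F \<Phi> x where "periodic_2pi F" "has_psi_beta_derivative \<psi> \<beta> F \<Phi>"
    "best_approx_L1 n \<Phi> = E"
    "\<psi> n * char_lambda \<psi> n * (1 / pi - 2 / char_lambda \<psi> n - 8 * char_alpha \<psi> n) * E
      \<le> \<bar>F x - fourier_sum (n - 1) F x\<bar>"
proof -
  note tail = tail_sums[OF psi dec inc n small]
  define \<alpha> where "\<alpha> = char_alpha \<psi> n"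
  define \<Lambda> where "\<Lambda> = char_lambda \<psi> n"
  have alpha: "0 < \<alpha>" "\<alpha> < 1 / 4" and Lambda: "\<Lambda> = n * \<alpha>"
    using characteristic_bounds[OF psi dec inc, of "real n"] n small by (auto simp: \<alpha>_def \<Lambda>_def)
  have psi_pos: "0 < \<psi> (real (n + j))" for j using psi n by (simp add: psi_class_def)
  \<comment> \<open>With this width, \<open>n \<epsilon> \<le> 1/2\<close> keeps the \<open>n\<close>-th coefficient of the bump positive, and the loss
    \<open>n \<epsilon> (\<Sum>k\<ge>n. \<psi> k)\<close> is of order \<open>\<psi> n \<lambda>(n)/n = \<psi> n \<alpha>(n)\<close>.\<close>
  define \<epsilon> where "\<epsilon> = 1 / (2 * real n ^ 2)"
  have n2: "real n \<le> real n ^ 2" using n by (simp add: power2_eq_square)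
  have "\<epsilon> \<le> 1 / 2" "0 < \<epsilon>" using n n2 by (auto simp: \<epsilon>_def field_simps)
  with pi_gt3 have eps: "0 < \<epsilon>" "\<epsilon> < pi" by linarith+
  obtain g where g: "continuous_on UNIV g" "periodic_2pi g" "\<And>t. 0 \<le> g t" "period_int g = 1"
    "\<And>t. t \<in> {-pi..pi} \<Longrightarrow> g t \<noteq> 0 \<Longrightarrow> \<bar>t\<bar> \<le> \<epsilon>"
    using bump_exists[OF eps] by metis
  note g_cos = bump_cos_coefficient_ge[OF g(1,3,4,5)]
  have gL1: "g \<in> L1_space" by (rule continuous_periodic_in_L1[OF g(1,2)])
  \<comment> \<open>The \<open>n\<close>-th cosine coefficient bounds \<open>E\<^sub>n(g)\<close> from below, the zero polynomial from above.\<close>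
  define e where "e = best_approx_L1 n g"
  have "cos 0 - n * \<epsilon> \<le> e"
    using g_cos[of 0 n] coefficient_le_best_approx_L1[OF gL1 n order_refl, of 0] by (simp add: e_def)
  moreover have "n * \<epsilon> \<le> 1 / 2" using n n2 by (simp add: \<epsilon>_def field_simps)
  ultimately have e_pos: "0 < e" by simp
  have "(\<lambda>x. 0) \<in> trig_polys (n - 1)"
    unfolding trig_polys_def by (intro CollectI exI[of _ "\<lambda>_. 0"]) simp
  from best_approx_L1_le[OF this, of g] have e_le: "e \<le> 1"
    using L1_space_period(2)[OF gL1] g(3,4) by (simp add: e_def)
  define s where "s = E / e"
  have s: "0 < s" "E \<le> s" using e_pos e_le E by (auto simp: s_def field_simps)
  define \<Phi> where "\<Phi> x = s * (g x - 1 / (2 * pi))" for x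
  \<comment> \<open>The summand \<open>0 / 2\<close> is the constant term \<open>a0 / 2\<close> of the representation.\<close>
  define F where "F x = 0 / 2 + (1 / pi) * period_int (\<lambda>t. Psi_kernel \<psi> \<beta> (x - t) * \<Phi> t)" for x
  have Phi_cont: "continuous_on UNIV \<Phi>" unfolding \<Phi>_def by (intro continuous_intros g)
  have PhiL1: "\<Phi> \<in> L1_space"
    using g(2) by (intro continuous_periodic_in_L1 Phi_cont) (simp add: periodic_2pi_def \<Phi>_def)
  note g_ai = L1_space_period(1)[OF gL1]
  have Phi_int: "period_int (\<lambda>t. w t * \<Phi> t) = s * (period_int (\<lambda>t. w t * g t) - 1 / (2 * pi) * period_int w)"
    if w: "continuous_on UNIV w" for w
  proof -
    have w_ai: "w absolutely_integrable_on {-pi..pi}"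
      by (intro absolutely_integrable_continuous_real continuous_on_subset[OF w]) auto
    have "period_int (\<lambda>t. w t * \<Phi> t) = period_int (\<lambda>t. s * (w t * g t - 1 / (2 * pi) * w t))"
      by (simp add: \<Phi>_def algebra_simps)
    also have "\<dots> = s * (period_int (\<lambda>t. w t * g t) - 1 / (2 * pi) * period_int w)"
      using set_integral_diff(2)[OF absolutely_integrable_continuous_mult[OF w g_ai]
          set_integrable_mult_right[of "1 / (2 * pi)", OF w_ai]]
      by simp
    finally show ?thesis .
  qed
  have "period_int (\<lambda>_. 1) = 2 * pi"
    using has_integral_const_real[of "1 :: real" "-pi" pi] by (intro continuous_period_int) auto
  then have "period_int \<Phi> = 0" using Phi_int[of "\<lambda>_. 1"] g(4) by simp
  then have deriv: "has_psi_beta_derivative \<psi> \<beta> F \<Phi>"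
    unfolding has_psi_beta_derivative_def F_def using PhiL1 by blast
  have Psi_per: "Psi_kernel \<psi> \<beta> (y + 2 * pi) = Psi_kernel \<psi> \<beta> y" for y
  proof -
    have "cos (real (Suc j) * (y + 2 * pi) - \<beta> * pi / 2) = cos (real (Suc j) * y - \<beta> * pi / 2)" for j
    proof -
      have "real (Suc j) * (y + 2 * pi) - \<beta> * pi / 2
          = (real (Suc j) * y - \<beta> * pi / 2) + 2 * real (Suc j) * pi" by (simp add: algebra_simps)
      then show ?thesis by (simp only: cos_add sin_2npi cos_2npi)
    qed
    then show ?thesis by (simp add: Psi_kernel_def)
  qed
  have F_per: "periodic_2pi F"
    unfolding periodic_2pi_def
  proof
    fix y
    have "Psi_kernel \<psi> \<beta> (y + 2 * pi - t) = Psi_kernel \<psi> \<beta> (y - t)" for t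
      using Psi_per[of "y - t"] by (simp only: diff_add_eq)
    then show "F (y + 2 * pi) = F y" by (simp only: F_def)
  qed
  have best: "best_approx_L1 n \<Phi> = E"
    using best_approx_L1_affine[OF s(1), of n g] e_pos by (simp add: \<Phi>_def[abs_def] e_def[symmetric] s_def)

  define \<gamma> where "\<gamma> = \<beta> * pi / 2"
  \<comment> \<open>The point \<open>x\<close> nearest to the origin at which \<open>n x\<close> equals \<open>\<gamma>\<close> modulo \<open>2\<pi>\<close>.\<close>
  define m where "m = round (\<gamma> / (2 * pi))"
  define x where "x = (\<gamma> - 2 * pi * m) / n"
  have x: "\<bar>x\<bar> \<le> pi / n"
  proof -
    have "\<bar>m - \<gamma> / (2 * pi)\<bar> \<le> 1 / 2" unfolding m_def by (rule of_int_round_abs_le)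
    then have "\<bar>\<gamma> - 2 * pi * m\<bar> \<le> pi"
      by (simp add: abs_le_iff field_simps)
    then show ?thesis using n by (simp add: x_def divide_right_mono)
  qed
  have cos_ge: "1 - j * (pi / n) \<le> cos (\<gamma> - real (n + j) * x)" for j :: nat
  proof -
    have "n * x = \<gamma> - 2 * pi * m" using n by (simp add: x_def)
    then have "\<gamma> - real (n + j) * x = - (j * x) + 2 * pi * m" by (simp add: algebra_simps)
    then have "cos (\<gamma> - real (n + j) * x) = cos (j * x)"
      by (simp add: cos_diff)
    moreover have "\<bar>cos (j * x) - cos 0\<bar> \<le> j * \<bar>x\<bar>"
      using abs_cos_diff_le[of "j * x" 0] by (simp add: abs_mult)
    moreover have "j * \<bar>x\<bar> \<le> j * (pi / n)" using x by (intro mult_left_mono) auto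
    ultimately show ?thesis by simp
  qed
  define R where "R = F x - fourier_sum (n - 1) F x"
  define q where "q j = \<psi> (real (n + j)) * (1 - n * \<epsilon>) - (j * \<psi> (real (n + j))) * (pi / n + \<epsilon>)" for j
  define S1 where "S1 = (\<Sum>j. \<psi> (real (n + j)))"
  define S2 where "S2 = (\<Sum>j. real j * \<psi> (real (n + j)))"
  have q_sums: "(\<lambda>j. s / pi * q j) sums (s / pi * (S1 * (1 - n * \<epsilon>) - S2 * (pi / n + \<epsilon>)))"
    unfolding q_def S1_def S2_def
    by (intro sums_mult sums_diff sums_mult2 summable_sums tail)
  have R_sums: "(\<lambda>j. \<psi> (real (n + j)) / pi * period_int (\<lambda>t. cos (real (n + j) * (x - t) - \<gamma>) * \<Phi> t)) sums R"
    unfolding R_def \<gamma>_def by (rule fourier_remainder_bound(1)[OF psi dec inc n small deriv])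
  have le: "s / pi * q j \<le> \<psi> (real (n + j)) / pi * period_int (\<lambda>t. cos (real (n + j) * (x - t) - \<gamma>) * \<Phi> t)" for j
  proof -
    define c where "c = \<gamma> - real (n + j) * x"
    have "cos (real (n + j) * (x - t) - \<gamma>) = cos (real (n + j) * t + c)" for t
      by (subst cos_minus[symmetric]) (simp add: c_def algebra_simps)
    moreover have "period_int (\<lambda>t. cos (real (n + j) * t + c)) = 0"
      using cos_has_integral_period[of "int (n + j)" c] n
      by (intro continuous_period_int continuous_intros) auto
    moreover have "1 - j * (pi / n) - real (n + j) * \<epsilon> \<le> period_int (\<lambda>t. cos (real (n + j) * t + c) * g t)"
      using g_cos[of c "n + j"] cos_ge[of j] by (simp add: c_def)
    moreover have "continuous_on UNIV (\<lambda>t. cos (real (n + j) * t + c))" by (intro continuous_intros)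
    ultimately have "s * (1 - j * (pi / n) - real (n + j) * \<epsilon>)
        \<le> period_int (\<lambda>t. cos (real (n + j) * (x - t) - \<gamma>) * \<Phi> t)"
      using s(1) by (simp add: Phi_int)
    then have "\<psi> (real (n + j)) / pi * (s * (1 - j * (pi / n) - real (n + j) * \<epsilon>))
      \<le> \<psi> (real (n + j)) / pi * period_int (\<lambda>t. cos (real (n + j) * (x - t) - \<gamma>) * \<Phi> t)"
      using psi_pos[of j] by (intro mult_left_mono) auto
    moreover have "s / pi * q j = \<psi> (real (n + j)) / pi * (s * (1 - j * (pi / n) - real (n + j) * \<epsilon>))"
      by (simp add: q_def algebra_simps)
    ultimately show ?thesis by (simp only:)
  qed
  have R_ge: "s / pi * (S1 * (1 - n * \<epsilon>) - S2 * (pi / n + \<epsilon>)) \<le> R"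
    by (rule sums_le[OF le q_sums R_sums])
  define Q where "Q = \<psi> n * \<Lambda> - 2 * pi * \<psi> n - 8 * pi * (\<psi> n * \<Lambda> * \<alpha>)"
  have Q_le: "Q \<le> S1 * (1 - n * \<epsilon>) - S2 * (pi / n + \<epsilon>)"
  proof -
    have n_pos: "0 < real n" "1 \<le> real n" using n by auto
    have S2_nonneg: "0 \<le> S2"
      unfolding S2_def by (intro suminf_nonneg tail mult_nonneg_nonneg less_imp_le[OF psi_pos]) simp
    have ppos: "0 < \<psi> n" using psi_pos[of 0] by simp
    have "S1 * (n * \<epsilon>) \<le> \<psi> n * \<Lambda> * (1 + 1 / \<Lambda> + 4 / 3 * \<alpha>) * (n * \<epsilon>)"
      unfolding S1_def \<alpha>_def \<Lambda>_def using eps by (intro mult_right_mono tail) auto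
    also have "\<dots> = \<psi> n * (\<alpha> / 2 + 1 / (2 * n) + 2 / 3 * (\<alpha> * \<alpha>))"
      using n_pos alpha by (simp add: Lambda \<epsilon>_def field_simps power2_eq_square)
    also have "\<dots> \<le> \<psi> n * 1"
    proof (intro mult_left_mono)
      have "\<alpha> * \<alpha> \<le> 1 / 4 * (1 / 4)" using alpha by (intro mult_mono) auto
      moreover have "1 / (2 * real n) \<le> 1 / 2" using n_pos by (simp add: field_simps)
      ultimately show "\<alpha> / 2 + 1 / (2 * n) + 2 / 3 * (\<alpha> * \<alpha>) \<le> 1" using alpha by linarith
    qed (use ppos in simp)
    finally have first: "S1 * (n * \<epsilon>) \<le> \<psi> n" by simp
    have "pi / n + \<epsilon> \<le> (pi + 1 / 2) / n"
      using n2 n_pos by (simp add: \<epsilon>_def field_simps)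
    then have "S2 * (pi / n + \<epsilon>) \<le> S2 * ((pi + 1 / 2) / n)"
      using S2_nonneg by (rule mult_left_mono)
    also have "\<dots> \<le> 4 / 3 * \<psi> n * \<Lambda> * (1 + 2 * \<Lambda>) * ((pi + 1 / 2) / n)"
      unfolding S2_def \<Lambda>_def by (intro mult_right_mono tail) (use pi_gt_zero in auto)
    also have "\<dots> = (pi + 1 / 2) * (4 / 3 * \<alpha>) * \<psi> n + 8 / 3 * (pi + 1 / 2) * (\<psi> n * \<Lambda> * \<alpha>)"
      using n_pos by (simp add: Lambda field_simps)
    also have "\<dots> \<le> (2 * pi - 1) * \<psi> n + 8 * pi * (\<psi> n * \<Lambda> * \<alpha>)"
    proof (intro add_mono mult_right_mono)
      have "(pi + 1 / 2) * (4 / 3 * \<alpha>) \<le> (pi + 1 / 2) * (1 / 3)"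
        using alpha pi_gt_zero by (intro mult_left_mono) auto
      also have "\<dots> \<le> 2 * pi - 1" using pi_gt3 by simp
      finally show "(pi + 1 / 2) * (4 / 3 * \<alpha>) \<le> 2 * pi - 1" .
      show "8 / 3 * (pi + 1 / 2) \<le> 8 * pi" using pi_gt3 by (simp add: distrib_left)
    qed (use ppos alpha n_pos Lambda in auto)
    finally have second: "S2 * (pi / n + \<epsilon>) \<le> (2 * pi - 1) * \<psi> n + 8 * pi * (\<psi> n * \<Lambda> * \<alpha>)" .
    have third: "\<psi> n * \<Lambda> \<le> S1"
      unfolding S1_def \<Lambda>_def by (rule tail(3))
    from first second third show ?thesis by (simp add: Q_def algebra_simps)
  qed
  have "\<psi> n * \<Lambda> * (1 / pi - 2 / \<Lambda> - 8 * \<alpha>) * E = E / pi * Q"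
    using alpha n by (simp add: Q_def Lambda field_simps)
  also have "\<dots> \<le> \<bar>R\<bar>"
  proof (cases "0 \<le> Q")
    case True
    then have "E / pi * Q \<le> s / pi * (S1 * (1 - n * \<epsilon>) - S2 * (pi / n + \<epsilon>))"
      using s E Q_le by (intro mult_mono divide_right_mono) auto
    then show ?thesis using R_ge by simp
  next
    case False
    then have "E / pi * Q \<le> 0" using E by (intro mult_nonneg_nonpos) auto
    then show ?thesis by simp
  qed
  finally show thesis
    using that[OF F_per deriv best] unfolding R_def \<Lambda>_def \<alpha>_def by blast
qed

text \<open>Both constants are moved along their ranges with a common parameter \<open>\<tau>\<close> from \<open>0\<close> to \<open>1\<close>; the right-hand
  side is affine in \<open>\<tau>\<close> and its values at the ends enclose \<open>N\<close>.\<close>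

lemma interpolate_remainder_constants:
  fixes P l a N :: real
  assumes pos: "0 < P" "0 < l" "0 < a"
    and lower: "P * (1 / pi - 2 / l - 8 * a) \<le> N"
    and upper: "N \<le> P * (1 / pi + (1 / pi) / l + 4 / (3 * pi) * a)"
  shows "\<exists>\<xi> \<eta>. -2 \<le> \<xi> \<and> \<xi> \<le> 2 + 1 / pi \<and> -8 \<le> \<eta> \<and> \<eta> \<le> 4 / 3 * (2 + 1 / pi) \<and>
    N = P * (1 / pi + \<xi> / l + \<eta> * a)"
proof -
  define w where "w = 1 / l"
  define q where "q = N / P - 1 / pi"
  define X where "X = 4 + 1 / pi"
  define Y where "Y = 8 + 4 / 3 * (2 + 1 / pi)"
  have w: "0 < w" and XY: "0 < X" "0 < Y" using pos by (auto simp: w_def X_def Y_def intro!: add_pos_pos)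
  define \<tau> where "\<tau> = (q + 2 * w + 8 * a) / (X * w + Y * a)"
  have den: "0 < X * w + Y * a" using w XY pos by (intro add_pos_pos mult_pos_pos)
  have N: "N = P * (1 / pi + q)" using pos by (simp add: q_def)
  have q_low: "- 2 * w - 8 * a \<le> q"
    using lower pos unfolding N by (simp add: w_def)
  have "q \<le> (1 / pi) * w + 4 / (3 * pi) * a"
    using upper pos unfolding N by (simp add: w_def)
  also have "\<dots> \<le> (2 + 1 / pi) * w + 4 / 3 * (2 + 1 / pi) * a"
    using w pos by (intro add_mono mult_right_mono) auto
  finally have q_up: "q + 2 * w + 8 * a \<le> X * w + Y * a"
    by (simp add: X_def Y_def algebra_simps)
  have tau: "0 \<le> \<tau>" "\<tau> \<le> 1" using q_low q_up den by (auto simp: \<tau>_def)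
  have "\<tau> * (X * w + Y * a) = q + 2 * w + 8 * a" using den by (simp add: \<tau>_def)
  then have "q = (-2 + \<tau> * X) * w + (-8 + \<tau> * Y) * a" by (simp add: algebra_simps)
  then have eq: "N = P * (1 / pi + (-2 + \<tau> * X) / l + (-8 + \<tau> * Y) * a)"
    unfolding N by (simp add: w_def)
  have bounds: "0 \<le> \<tau> * X" "\<tau> * X \<le> X" "0 \<le> \<tau> * Y" "\<tau> * Y \<le> Y"
    using tau XY by (auto simp: mult_left_le_one_le)
  have "-2 \<le> -2 + \<tau> * X" "-2 + \<tau> * X \<le> 2 + 1 / pi" "-8 \<le> -8 + \<tau> * Y"
    "-8 + \<tau> * Y \<le> 4 / 3 * (2 + 1 / pi)"
    using bounds unfolding X_def Y_def by linarith+
  with eq show ?thesis by blast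
qed

section \<open>The estimate and its sharpness\<close>

theorem mainTheorem4:
  fixes \<psi> :: "real \<Rightarrow> real" and \<beta> :: real
  assumes "\<psi> \<in> \<MM>"
    and "decreases_to_zero (char_alpha \<psi>)"
    and "increases_to_infinity (char_lambda \<psi>)"
  shows "(\<forall>n::nat. n \<ge> 1 \<and> char_alpha \<psi> (real n) < 1 / 4 \<longrightarrow>
      (\<forall>f \<in> C_psi_beta_L1 \<psi> \<beta>. \<forall>\<phi>. has_psi_beta_derivative \<psi> \<beta> f \<phi> \<longrightarrow>
        (\<exists>\<xi>\<^sub>3 \<xi>\<^sub>4. 0 \<le> \<xi>\<^sub>3 \<and> \<xi>\<^sub>3 \<le> 1 / pi \<and> 0 \<le> \<xi>\<^sub>4 \<and> \<xi>\<^sub>4 \<le> 4 / (3 * pi) \<and>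
          C_norm (\<lambda>x. f x - fourier_sum (n - 1) f x)
            \<le> \<psi> (real n) * char_lambda \<psi> (real n) *
              (1 / pi + \<xi>\<^sub>3 / char_lambda \<psi> (real n) + \<xi>\<^sub>4 * char_alpha \<psi> (real n)) *
              best_approx_L1 n \<phi>)))
    \<and>
    (\<forall>n::nat. n \<ge> 1 \<longrightarrow>
      (\<forall>f \<in> C_psi_beta_L1 \<psi> \<beta>. \<forall>\<phi>. has_psi_beta_derivative \<psi> \<beta> f \<phi> \<longrightarrow>
        (\<exists>F \<in> C_psi_beta_L1 \<psi> \<beta>. \<exists>\<Phi>. has_psi_beta_derivative \<psi> \<beta> F \<Phi> \<and>
          best_approx_L1 n \<Phi> = best_approx_L1 n \<phi> \<and>
          (char_alpha \<psi> (real n) < 1 / 4 \<longrightarrow>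
            (\<exists>\<xi>\<^sub>5 \<xi>\<^sub>6. -2 \<le> \<xi>\<^sub>5 \<and> \<xi>\<^sub>5 \<le> 2 + 1 / pi \<and>
              -8 \<le> \<xi>\<^sub>6 \<and> \<xi>\<^sub>6 \<le> 4 / 3 * (2 + 1 / pi) \<and>
              C_norm (\<lambda>x. F x - fourier_sum (n - 1) F x)
                = \<psi> (real n) * char_lambda \<psi> (real n) *
                  (1 / pi + \<xi>\<^sub>5 / char_lambda \<psi> (real n) + \<xi>\<^sub>6 * char_alpha \<psi> (real n)) *
                  best_approx_L1 n \<phi>)))))"
proof (intro conjI allI impI ballI)
  fix n :: nat and f \<phi>
  assume n: "1 \<le> n \<and> char_alpha \<psi> (real n) < 1 / 4" and f: "has_psi_beta_derivative \<psi> \<beta> f \<phi>"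
  have "C_norm (\<lambda>x. f x - fourier_sum (n - 1) f x) \<le> \<psi> n * char_lambda \<psi> n *
      (1 / pi + (1 / pi) / char_lambda \<psi> n + 4 / (3 * pi) * char_alpha \<psi> n) * best_approx_L1 n \<phi>"
    unfolding C_norm_def
    by (rule cSUP_least) (use n fourier_remainder_bound(2)[OF assms _ _ f] in auto)
  then show "\<exists>\<xi>\<^sub>3 \<xi>\<^sub>4. 0 \<le> \<xi>\<^sub>3 \<and> \<xi>\<^sub>3 \<le> 1 / pi \<and> 0 \<le> \<xi>\<^sub>4 \<and> \<xi>\<^sub>4 \<le> 4 / (3 * pi) \<and>
      C_norm (\<lambda>x. f x - fourier_sum (n - 1) f x)
        \<le> \<psi> (real n) * char_lambda \<psi> (real n) *
          (1 / pi + \<xi>\<^sub>3 / char_lambda \<psi> (real n) + \<xi>\<^sub>4 * char_alpha \<psi> (real n)) * best_approx_L1 n \<phi>"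
    by (intro exI[of _ "1 / pi"] exI[of _ "4 / (3 * pi)"]) auto
next
  fix n :: nat and f \<phi>
  assume n: "1 \<le> n" and fC: "f \<in> C_psi_beta_L1 \<psi> \<beta>" and f: "has_psi_beta_derivative \<psi> \<beta> f \<phi>"
  define E where "E = best_approx_L1 n \<phi>"
  define P where "P = \<psi> n * char_lambda \<psi> n * E"
  let ?N = "\<lambda>F. C_norm (\<lambda>x. F x - fourier_sum (n - 1) F x)"
  let ?val = "\<lambda>\<xi> \<eta>. \<psi> n * char_lambda \<psi> n * (1 / pi + \<xi> / char_lambda \<psi> n + \<eta> * char_alpha \<psi> n) * E"
  let ?goal = "\<exists>F \<in> C_psi_beta_L1 \<psi> \<beta>. \<exists>\<Phi>. has_psi_beta_derivative \<psi> \<beta> F \<Phi> \<and>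
    best_approx_L1 n \<Phi> = E \<and> (char_alpha \<psi> n < 1 / 4 \<longrightarrow>
      (\<exists>\<xi> \<eta>. -2 \<le> \<xi> \<and> \<xi> \<le> 2 + 1 / pi \<and> -8 \<le> \<eta> \<and> \<eta> \<le> 4 / 3 * (2 + 1 / pi) \<and> ?N F = ?val \<xi> \<eta>))"
  have upper: "bdd_above (range (\<lambda>x. \<bar>F x - fourier_sum (n - 1) F x\<bar>)) \<and> ?N F \<le> ?val (1 / pi) (4 / (3 * pi))"
    if "has_psi_beta_derivative \<psi> \<beta> F \<Phi>" "best_approx_L1 n \<Phi> = E" "char_alpha \<psi> n < 1 / 4" for F \<Phi>
  proof -
    have "\<bar>F x - fourier_sum (n - 1) F x\<bar> \<le> ?val (1 / pi) (4 / (3 * pi))" for x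
      using fourier_remainder_bound(2)[OF assms n that(3,1)] that(2) by simp
    then show ?thesis
      unfolding C_norm_def by (auto intro!: cSUP_least bdd_aboveI2)
  qed
  have "0 \<le> E" unfolding E_def by (rule best_approx_L1_nonneg)
  \<comment> \<open>If \<open>\<alpha>(n) \<ge> 1/4\<close> nothing is claimed about the norm, and if \<open>E = 0\<close> both sides vanish; \<open>f\<close> itself
    serves in these cases.\<close>
  then consider "char_alpha \<psi> n \<ge> 1 / 4" | "char_alpha \<psi> n < 1 / 4" "E = 0" | "char_alpha \<psi> n < 1 / 4" "0 < E"
    by linarith
  then have ?goal
  proof cases
    case 1
    then show ?thesis using f fC E_def by (intro bexI[OF _ fC] exI[of _ \<phi>]) auto
  next
    case 2
    note up = upper[OF f E_def[symmetric] 2(1)]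
    have "0 \<le> \<bar>f 0 - fourier_sum (n - 1) f 0\<bar>" by simp
    also have "\<dots> \<le> ?N f"
      unfolding C_norm_def by (rule cSUP_upper) (use up in auto)
    finally have "?N f = 0" using up 2(2) by simp
    then show ?thesis using f E_def 2
      by (intro bexI[OF _ fC] exI[of _ \<phi>] conjI impI exI[of _ 0]) auto
  next
    case 3
    obtain F \<Phi> x where F: "periodic_2pi F" "has_psi_beta_derivative \<psi> \<beta> F \<Phi>" "best_approx_L1 n \<Phi> = E"
      and low: "?val (-2) (-8) \<le> \<bar>F x - fourier_sum (n - 1) F x\<bar>"
      using extremal_function[OF assms n 3, of \<beta>] by (auto simp: algebra_simps)
    note up = upper[OF F(2,3) 3(1)]
    have "\<bar>F x - fourier_sum (n - 1) F x\<bar> \<le> ?N F"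
      unfolding C_norm_def by (rule cSUP_upper) (use up in auto)
    with low have low': "?val (-2) (-8) \<le> ?N F" by simp
    have pos: "0 < P" "0 < char_lambda \<psi> n" "0 < char_alpha \<psi> n"
      using characteristic_bounds(1,2)[OF assms, of "real n"] n 3(2) assms(1)
      by (auto simp: P_def psi_class_def)
    have "\<exists>\<xi> \<eta>. -2 \<le> \<xi> \<and> \<xi> \<le> 2 + 1 / pi \<and> -8 \<le> \<eta> \<and> \<eta> \<le> 4 / 3 * (2 + 1 / pi) \<and>
        ?N F = P * (1 / pi + \<xi> / char_lambda \<psi> n + \<eta> * char_alpha \<psi> n)"
      by (rule interpolate_remainder_constants[OF pos])
        (use low' up in \<open>auto simp: P_def mult.commute mult.left_commute\<close>)
    moreover have "P * (1 / pi + \<xi> / char_lambda \<psi> n + \<eta> * char_alpha \<psi> n) = ?val \<xi> \<eta>" for \<xi> \<eta>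
      by (simp add: P_def)
    ultimately have "\<exists>\<xi> \<eta>. -2 \<le> \<xi> \<and> \<xi> \<le> 2 + 1 / pi \<and> -8 \<le> \<eta> \<and> \<eta> \<le> 4 / 3 * (2 + 1 / pi) \<and> ?N F = ?val \<xi> \<eta>"
      by simp
    moreover have "F \<in> C_psi_beta_L1 \<psi> \<beta>" using F by (auto simp: C_psi_beta_L1_def)
    ultimately show ?thesis using F by blast
  qed
  then show "\<exists>F \<in> C_psi_beta_L1 \<psi> \<beta>. \<exists>\<Phi>. has_psi_beta_derivative \<psi> \<beta> F \<Phi> \<and>
          best_approx_L1 n \<Phi> = best_approx_L1 n \<phi> \<and>
          (char_alpha \<psi> (real n) < 1 / 4 \<longrightarrow>
            (\<exists>\<xi>\<^sub>5 \<xi>\<^sub>6. -2 \<le> \<xi>\<^sub>5 \<and> \<xi>\<^sub>5 \<le> 2 + 1 / pi \<and>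
              -8 \<le> \<xi>\<^sub>6 \<and> \<xi>\<^sub>6 \<le> 4 / 3 * (2 + 1 / pi) \<and>
              ?N F = \<psi> (real n) * char_lambda \<psi> (real n) *
                  (1 / pi + \<xi>\<^sub>5 / char_lambda \<psi> (real n) + \<xi>\<^sub>6 * char_alpha \<psi> (real n)) *
                  best_approx_L1 n \<phi>))"
    unfolding E_def .
qed

end
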